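(* Let $r$ be a Hermitian symmetric polynomial in one complex variable $z$ with $r(z,\overline z)\ge 0$ for all $z\in\mathbb{C}$. The following are equivalent: (1) There is a holomorphic polynomial $h$ and a Hermitian symmetric polynomial $R$ such that $r=|h|^2R$, $R(z,\overline z)>0$ for all $z\in\mathbb{C}$, and the total degree of $R$ is twice the degree of $R$ in $z$. (2) There is a holomorphic polynomial $h$ such that $r=|h|^2R$ with $R\in\mathcal{Q}(1)$. (3) $r\in\mathcal{Q}(1)$. (4) There is a holomorphic polynomial $h$ such that $r=|h|^2R$ with $R\in\mathcal{Q}'(1)$. (5) $r\in\mathcal{Q}'(1)$.
   Context: A Hermitian symmetric polynomial in $n$ variables is a polynomial $r(z,\overline{w})=\sum c_{\alpha\beta}z^\alpha\overline w^\beta$ with $c_{\alpha\beta}=\overline{c_{\beta\alpha}}$. Its degree in $z$ is the largest $|\alpha|$ with some $c_{\alpha\beta}\neq 0$, and its total degree is the largest $|\alpha|+|\beta|$ with $c_{\alpha\beta}\ne 0$ (treating $z$ and $\overline z$ as independent variables). For a holomorphic polynomial mapping $F=(F_1,\dots,F_N)$, $\|F\|^2=\sum|F_j|^2$. $\mathcal{Q}(n)$: Hermitian symmetric polynomials $r$ with $r=\|F\|^2/\|G\|^2$ for holomorphic polynomial mappings $F,G$, $G\not\equiv 0$. $\mathcal{Q}'(n)$: Hermitian symmetric polynomials $r$ with $r(z,\overline z)\ge0$ for all $z$ such that there exist a Hermitian symmetric polynomial $s\ge 0$, not identically $0$, and a holomorphic polynomial mapping $F$ with $rs=\|F\|^2$.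 *)

theory Defs
  imports Complex_Main "HOL-Computational_Algebra.Polynomial"
begin

text \<open>A polynomial r(z, wbar) = sum c_ab z^a wbar^b in one complex variable z, with z and
  wbar treated as independent variables, is represented as a nested polynomial
  r :: complex poly poly: the outer variable is wbar, the inner one is z, so
  c_ab = coeff (coeff r b) a.\<close>

type_synonym hpoly = "complex poly poly"

definition hcoeff :: "hpoly \<Rightarrow> nat \<Rightarrow> nat \<Rightarrow> complex" where
  "hcoeff r a b = coeff (coeff r b) a"

definition hermitian :: "hpoly \<Rightarrow> bool" where
  "hermitian r \<longleftrightarrow> (\<forall>a b. hcoeff r a b = cnj (hcoeff r b a))"

definition heval :: "hpoly \<Rightarrow> complex \<Rightarrow> complex \<Rightarrow> complex" where
  "heval r z w = poly (map_poly (\<lambda>p. poly p z) r) (cnj w)"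

definition hdiag :: "hpoly \<Rightarrow> complex \<Rightarrow> complex" where
  "hdiag r z = heval r z z"

text \<open>The Hermitian polynomial |h|^2 = h(z) conj(h(w)) of a holomorphic polynomial h.\<close>
definition habs2 :: "complex poly \<Rightarrow> hpoly" where
  "habs2 h = map_poly (\<lambda>c. smult (cnj c) h) h"

definition hnorm2 :: "complex poly list \<Rightarrow> hpoly" where
  "hnorm2 F = sum_list (map habs2 F)"

text \<open>Degree in z and total degree (z, zbar independent); both 0 for the zero polynomial.\<close>
definition deg_z :: "hpoly \<Rightarrow> nat" where
  "deg_z r = Max ({a. \<exists>b. hcoeff r a b \<noteq> 0} \<union> {0})"

definition total_deg :: "hpoly \<Rightarrow> nat" where
  "total_deg r = Max ({a + b | a b. hcoeff r a b \<noteq> 0} \<union> {0})"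

text \<open>Q(1): r = ||F||^2 / ||G||^2 with G not identically zero, i.e. r ||G||^2 = ||F||^2.\<close>
definition Q1 :: "hpoly set" where
  "Q1 = {r. hermitian r \<and> (\<exists>F G. (\<exists>g\<in>set G. g \<noteq> 0) \<and> r * hnorm2 G = hnorm2 F)}"

definition Q1' :: "hpoly set" where
  "Q1' = {r. hermitian r \<and> (\<forall>z. Re (hdiag r z) \<ge> 0) \<and>
     (\<exists>s F. hermitian s \<and> (\<forall>z. Re (hdiag s z) \<ge> 0) \<and> s \<noteq> 0 \<and> r * s = hnorm2 F)}"

end

theory Submission
  imports Defs "HOL-Analysis.Analysis"
begin

text \<open>Write $W = 1 + z \overline{w}$.
  If $r s = \|F\|^2$ and $r(a) = 0$, then every $F_j$ vanishes at $a$, so $|z - a|^2$ divides $r$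
  or $s$ and can be cancelled; iterating removes all zeros of $r$. The coefficient of
  $z^m \overline{z}^m$ in $\|F\|^2$, $m = \deg F$, is positive, which forces the total degree of
  $r$ to be twice its degree in $z$.

  Conversely let $R > 0$ be of bidegree $(d, d)$ with nonvanishing top coefficient. By compactness
  $R = p + \delta W^d$ with $\delta > 0$ and $p \ge 0$ on the diagonal. Integrating $p |f|^2$
  against $(1 + |z|^2)^{-L-2}$ with $L = N + 2d$ gives a nonnegative
  Hermitian form in $f$, $\deg f \le N + d$. Normal ordering (two
  applications of Vandermonde's identity) shows that, after rescaling, its matrix is the coefficient
  matrix of $W^N (p + e_N)$, where $e_N$ has bidegree at most $(d, d)$ and is $O(1/N)$. For large $N$ the
  polynomial $\delta W^d - e_N$ is itself a squared norm, hence so is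
  $W^N R = W^N (p + e_N) + W^N (\delta W^d - e_N)$.\<close>

section \<open>Hermitian polynomials\<close>

lemma sum_swap4:
  "(\<Sum>a\<in>A. \<Sum>b\<in>B. \<Sum>k\<in>K. \<Sum>l\<in>L. h a b k l) = (\<Sum>k\<in>K. \<Sum>l\<in>L. \<Sum>a\<in>A. \<Sum>b\<in>B. h a b k l)"
proof -
  have "(\<Sum>b\<in>B. \<Sum>k\<in>K. \<Sum>l\<in>L. h a b k l) = (\<Sum>k\<in>K. \<Sum>l\<in>L. \<Sum>b\<in>B. h a b k l)" for a
    by (subst sum.swap) (intro sum.cong refl sum.swap)
  then show ?thesis
    by simp (subst sum.swap, intro sum.cong refl sum.swap)
qed

text \<open>Substituting the constant polynomial \<open>[:cnj w:]\<close> for the outer variable is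
  a ring homomorphism, so the evaluation laws reduce to those of \<open>poly\<close>.\<close>

lemma heval_eq: "heval r z w = poly (poly r [:cnj w:]) z"
  unfolding heval_def by (induction r) (auto simp: map_poly_pCons)

lemma heval_ring [simp]:
  "heval 0 z w = 0" "heval 1 z w = 1"
  "heval (r + s) z w = heval r z w + heval s z w"
  "heval (r - s) z w = heval r z w - heval s z w"
  "heval (r * s) z w = heval r z w * heval s z w"
  "heval (r ^ n) z w = heval r z w ^ n"
  "heval [:[:c:]:] z w = c"
  by (auto simp: heval_eq poly_power)

lemma heval_sum [simp]: "heval (\<Sum>i\<in>I. f i) z w = (\<Sum>i\<in>I. heval (f i) z w)"
  by (simp add: heval_eq poly_sum)

lemma heval_monom [simp]: "heval (monom (monom c a) b) z w = c * z ^ a * cnj w ^ b"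
  by (simp add: heval_eq poly_monom poly_power)

lemma heval_smult [simp]: "heval (smult p r) z w = poly p z * heval r z w"
  by (simp add: heval_eq)

text \<open>A nonzero \<open>r\<close> has finitely many roots in the integral domain of inner
  polynomials, whereas here every constant \<open>[:c:]\<close> is a root, as
  \<open>poly r [:c:]\<close> vanishes at all z. Polynomial identities can therefore be checked at
  independent points z and w.\<close>

lemma heval_eq_0_imp:
  assumes "\<And>z w. heval r z w = 0"
  shows "r = 0"
proof (rule ccontr)
  assume "r \<noteq> 0"
  then have fin: "finite {x. poly r x = 0}" by (rule poly_roots_finite)
  have "poly r [:c:] = 0" for c
  proof (rule ccontr)
    assume "poly r [:c:] \<noteq> 0"
    then have "finite {z. poly (poly r [:c:]) z = 0}" by (rule poly_roots_finite)
    moreover have "{z. poly (poly r [:c:]) z = 0} = UNIV"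
      using assms[of _ "cnj c"] by (auto simp: heval_eq)
    ultimately show False using infinite_UNIV_char_0[where 'a=complex] by simp
  qed
  then have "range (\<lambda>c. [:c:]) \<subseteq> {x. poly r x = 0}" by auto
  with fin have "finite (range (\<lambda>c::complex. [:c:]))" by (rule finite_subset[rotated])
  moreover have "inj (\<lambda>c::complex. [:c:])" by (auto simp: inj_def)
  ultimately show False using infinite_UNIV_char_0[where 'a=complex]
    using finite_imageD by blast
qed

lemma hpoly_eqI_heval:
  assumes "\<And>z w. heval r z w = heval s z w"
  shows "r = s"
  using heval_eq_0_imp[of "r - s"] assms by simp

lemma hpoly_eqI:
  assumes "\<And>a b. hcoeff r a b = hcoeff s a b"
  shows "r = s"
  using assms by (auto simp: hcoeff_def poly_eq_iff)

lemma hcoeff_ring [simp]: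
  "hcoeff 0 a b = 0"
  "hcoeff (r + s) a b = hcoeff r a b + hcoeff s a b"
  "hcoeff (r - s) a b = hcoeff r a b - hcoeff s a b"
  by (auto simp: hcoeff_def)

lemma hcoeff_sum [simp]: "hcoeff (\<Sum>i\<in>I. f i) a b = (\<Sum>i\<in>I. hcoeff (f i) a b)"
  by (simp add: hcoeff_def coeff_sum)

lemma hcoeff_monom [simp]:
  "hcoeff (monom (monom c i) j) a b = (if a = i \<and> b = j then c else 0)"
  by (auto simp: hcoeff_def)

lemma hcoeff_scale [simp]: "hcoeff ([:[:c:]:] * r) a b = c * hcoeff r a b"
  by (simp add: hcoeff_def)

lemma hcoeff_smult [simp]: "hcoeff (smult [:c:] r) a b = c * hcoeff r a b"
  by (simp add: hcoeff_def)

section \<open>Bidegree bounds and finite coefficient arrays\<close>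

definition bideg_le :: "nat \<Rightarrow> hpoly \<Rightarrow> bool" where
  "bideg_le n r \<longleftrightarrow> (\<forall>a b. hcoeff r a b \<noteq> 0 \<longrightarrow> a \<le> n \<and> b \<le> n)"

definition hpoly_of :: "nat \<Rightarrow> (nat \<Rightarrow> nat \<Rightarrow> complex) \<Rightarrow> hpoly" where
  "hpoly_of n c = (\<Sum>a\<le>n. \<Sum>b\<le>n. monom (monom (c a b) a) b)"

lemma hcoeff_hpoly_of [simp]:
  "hcoeff (hpoly_of n c) a b = (if a \<le> n \<and> b \<le> n then c a b else 0)"
proof -
  have "hcoeff (hpoly_of n c) a b
      = (\<Sum>i\<le>n. if a = i then (\<Sum>j\<le>n. if b = j then c i j else 0) else 0)"
    unfolding hpoly_of_def hcoeff_sum hcoeff_monom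
    by (intro sum.cong refl) (auto simp: )
  also have "\<dots> = (if a \<le> n \<and> b \<le> n then c a b else 0)"
    by (simp add: sum.delta)
  finally show ?thesis .
qed

lemma heval_hpoly_of:
  "heval (hpoly_of n c) z w = (\<Sum>a\<le>n. \<Sum>b\<le>n. c a b * z ^ a * cnj w ^ b)"
  by (simp add: hpoly_of_def)

lemma hpoly_of_hcoeff:
  assumes "bideg_le n r"
  shows "hpoly_of n (hcoeff r) = r"
  using assms by (intro hpoly_eqI) (auto simp: bideg_le_def)

lemma heval_altdef:
  assumes "bideg_le n r"
  shows "heval r z w = (\<Sum>a\<le>n. \<Sum>b\<le>n. hcoeff r a b * z ^ a * cnj w ^ b)"
  using heval_hpoly_of[of n "hcoeff r" z w] hpoly_of_hcoeff[OF assms] by simp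

lemma bideg_le_exists: "\<exists>n. bideg_le n r"
proof -
  define n where "n = degree r + (\<Sum>b\<le>degree r. degree (coeff r b))"
  have "a \<le> n \<and> b \<le> n" if "hcoeff r a b \<noteq> 0" for a b
  proof -
    from that have b: "b \<le> degree r" unfolding hcoeff_def by (metis coeff_0 le_degree)
    have "a \<le> degree (coeff r b)" using that le_degree by (auto simp: hcoeff_def)
    also have "\<dots> \<le> (\<Sum>b\<le>degree r. degree (coeff r b))"
      using b by (intro member_le_sum) auto
    finally show ?thesis using b by (auto simp: n_def)
  qed
  then show ?thesis by (auto simp: bideg_le_def)
qed

lemma bideg_le_mono: "bideg_le m r \<Longrightarrow> m \<le> n \<Longrightarrow> bideg_le n r"
  by (meson bideg_le_def le_trans)

lemma bideg_le_add: "bideg_le n r \<Longrightarrow> bideg_le n s \<Longrightarrow> bideg_le n (r + s)"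
  unfolding bideg_le_def by (metis hcoeff_ring(2) add.right_neutral)

lemma bideg_le_sum: "(\<And>i. i \<in> I \<Longrightarrow> bideg_le n (f i)) \<Longrightarrow> bideg_le n (\<Sum>i\<in>I. f i)"
  by (induction I rule: infinite_finite_induct)
     (auto intro: bideg_le_add simp: bideg_le_def[of _ 0])

lemma hpoly_mult_expand:
  assumes "bideg_le m r" "bideg_le n s"
  shows "r * s = (\<Sum>a\<le>m. \<Sum>b\<le>m. \<Sum>i\<le>n. \<Sum>j\<le>n.
      monom (monom (hcoeff r a b * hcoeff s i j) (a + i)) (b + j))"
  by (intro hpoly_eqI_heval)
     (simp add: heval_altdef[OF assms(1)] heval_altdef[OF assms(2)] sum_distrib_right,
        simp add: sum_distrib_left power_add mult_ac)

lemma bideg_le_mult: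
  assumes "bideg_le m r" "bideg_le n s"
  shows "bideg_le (m + n) (r * s)"
proof -
  have "bideg_le (m + n) (\<Sum>a\<le>m. \<Sum>b\<le>m. \<Sum>i\<le>n. \<Sum>j\<le>n.
      monom (monom (hcoeff r a b * hcoeff s i j) (a + i)) (b + j))"
    by (intro bideg_le_sum) (auto simp: bideg_le_def)
  then show ?thesis by (simp only: hpoly_mult_expand[OF assms])
qed

text \<open>Conjugate transpose of the coefficient matrix. Every bidegree bound yields the same
  polynomial, so an arbitrary one may be chosen.\<close>

definition star :: "hpoly \<Rightarrow> hpoly" where
  "star r = hpoly_of (SOME n. bideg_le n r) (\<lambda>a b. cnj (hcoeff r b a))"

lemma hcoeff_star [simp]: "hcoeff (star r) a b = cnj (hcoeff r b a)"
  using someI_ex[OF bideg_le_exists[of r]] by (auto simp: star_def bideg_le_def)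

lemma heval_star [simp]: "heval (star r) z w = cnj (heval r w z)"
proof -
  obtain n where n: "bideg_le n r" using bideg_le_exists by blast
  then have n': "bideg_le n (star r)" by (auto simp: bideg_le_def)
  show ?thesis
    unfolding heval_altdef[OF n] heval_altdef[OF n'] 
    by (subst sum.swap) (simp add: mult_ac)
qed

lemma hermitian_iff_star: "hermitian r \<longleftrightarrow> star r = r"
  unfolding hermitian_def by (metis hcoeff_star hpoly_eqI)

lemma hermitian_iff_heval: "hermitian r \<longleftrightarrow> (\<forall>z w. heval r z w = cnj (heval r w z))"
  unfolding hermitian_iff_star by (metis heval_star hpoly_eqI_heval)

lemma star_mult: "star (r * s) = star r * star s"
  by (rule hpoly_eqI_heval) simp

lemma Im_hdiag:
  assumes "hermitian r"
  shows "Im (hdiag r z) = 0"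
proof -
  have "hdiag r z = cnj (hdiag r z)"
    using assms unfolding hermitian_iff_heval hdiag_def by blast
  then show ?thesis by (simp add: complex_eq_iff)
qed

lemma isCont_hdiag: "isCont (hdiag r) z"
proof -
  obtain n where n: "bideg_le n r" using bideg_le_exists by blast
  have "hdiag r = (\<lambda>z. \<Sum>a\<le>n. \<Sum>b\<le>n. hcoeff r a b * z ^ a * cnj z ^ b)"
    by (rule ext) (simp add: hdiag_def heval_altdef[OF n])
  then show ?thesis by (auto intro!: continuous_intros)
qed

text \<open>The point \<open>a\<close> is a limit of other points and the diagonal restriction is
  continuous, so the weak inequality passes to \<open>a\<close>.\<close>

lemma Re_hdiag_nonneg_at:
  assumes "\<And>z. z \<noteq> a \<Longrightarrow> Re (hdiag q z) \<ge> 0"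
  shows "Re (hdiag q a) \<ge> 0"
proof -
  have "((\<lambda>z. Re (hdiag q z)) \<longlongrightarrow> Re (hdiag q a)) (at a)"
    using isCont_hdiag[of a q] by (intro tendsto_Re) (simp add: isCont_def)
  then show ?thesis
    by (rule tendsto_lowerbound) (auto simp: eventually_at_filter assms)
qed

section \<open>Squared norms and the cone they form\<close>

lemma hcoeff_habs2 [simp]: "hcoeff (habs2 h) a b = coeff h a * cnj (coeff h b)"
  by (simp add: hcoeff_def habs2_def coeff_map_poly)

lemma bideg_le_habs2: "bideg_le (degree h) (habs2 h)"
  by (auto simp: bideg_le_def le_degree)

lemma heval_habs2 [simp]: "heval (habs2 h) z w = poly h z * cnj (poly h w)"
  unfolding heval_altdef[OF bideg_le_habs2] poly_altdef
  by (simp add: sum_product mult_ac)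

lemma hnorm2_simps [simp]: "hnorm2 [] = 0" "hnorm2 (f # F) = habs2 f + hnorm2 F"
  "hnorm2 (F @ G) = hnorm2 F + hnorm2 G"
  by (simp_all add: hnorm2_def)

lemma heval_hnorm2: "heval (hnorm2 F) z w = (\<Sum>f\<leftarrow>F. poly f z * cnj (poly f w))"
  by (induction F) auto

lemma hermitian_hnorm2: "hermitian (hnorm2 F)"
  unfolding hermitian_iff_heval heval_hnorm2
proof (intro allI)
  show "(\<Sum>f\<leftarrow>F. poly f z * cnj (poly f w)) = cnj (\<Sum>f\<leftarrow>F. poly f w * cnj (poly f z))" for z w
    by (induction F) auto
qed

lemma Re_hdiag_hnorm2: "Re (hdiag (hnorm2 F) z) = (\<Sum>f\<leftarrow>F. (cmod (poly f z))\<^sup>2)"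
  unfolding hdiag_def by (induction F) (auto simp: cmod_power2 simp flip: power2_eq_square)

lemma Re_hdiag_hnorm2_nonneg: "Re (hdiag (hnorm2 F) z) \<ge> 0"
  unfolding Re_hdiag_hnorm2 by (intro sum_list_nonneg) auto

lemma habs2_mult: "habs2 (f * g) = habs2 f * habs2 g"
  by (rule hpoly_eqI_heval) simp

lemma habs2_mult_hnorm2: "habs2 h * hnorm2 F = hnorm2 (map ((*) h) F)"
  by (induction F) (auto simp: distrib_left habs2_mult)

lemma habs2_eq_0_iff [simp]: "habs2 h = 0 \<longleftrightarrow> h = 0"
proof
  assume "habs2 h = 0"
  then have "hcoeff (habs2 h) a a = 0" for a by simp
  then show "h = 0" by (auto simp: poly_eq_iff)
qed (simp add: habs2_def)

lemma hnorm2_eq_0_imp: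
  assumes "hnorm2 F = 0" "f \<in> set F"
  shows "f = 0"
proof -
  have "poly f z = 0" for z
  proof -
    have "(\<Sum>f\<leftarrow>F. (cmod (poly f z))\<^sup>2) = 0"
      using assms(1) Re_hdiag_hnorm2[of F z] by (simp add: hdiag_def)
    then show ?thesis using assms(2)
      by (subst (asm) sum_list_nonneg_eq_0_iff) auto
  qed
  then show ?thesis using poly_all_0_iff_0 by blast
qed

definition sos :: "hpoly set" where "sos = range hnorm2"

lemma sos_add: "r \<in> sos \<Longrightarrow> s \<in> sos \<Longrightarrow> r + s \<in> sos"
  unfolding sos_def by (auto simp flip: hnorm2_simps(3))

lemma habs2_in_sos: "habs2 h \<in> sos"
  unfolding sos_def by (rule range_eqI[of _ _ "[h]"]) simp

lemma const_in_sos: "c \<ge> 0 \<Longrightarrow> [:[:of_real c:]:] \<in> sos"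
proof -
  assume "c \<ge> 0"
  then have "[:[:of_real c:]:] = habs2 [:of_real (sqrt c):]"
    by (intro hpoly_eqI_heval) (simp flip: of_real_mult)
  then show ?thesis using habs2_in_sos by simp
qed

text \<open>Since |f|^2 |g|^2 = |fg|^2, the product of two sums of squares expands into one such
  sum.\<close>

lemma sos_mult:
  assumes "r \<in> sos" "s \<in> sos"
  shows "r * s \<in> sos"
proof -
  obtain F G where r: "r = hnorm2 F" and s: "s = hnorm2 G" using assms by (auto simp: sos_def)
  have "hnorm2 F * hnorm2 G \<in> sos"
  proof (induction F)
    case Nil
    show ?case using const_in_sos[of 0] by simp
  next
    case (Cons f F)
    then show ?case
      by (simp add: distrib_right habs2_mult_hnorm2) (intro sos_add; simp add: sos_def)
  qed
  then show ?thesis using r s by simp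
qed

lemma sos_sum: "(\<And>i. i \<in> I \<Longrightarrow> f i \<in> sos) \<Longrightarrow> (\<Sum>i\<in>I. f i) \<in> sos"
  using const_in_sos[of 0] by (induction I rule: infinite_finite_induct) (auto intro: sos_add)

lemma sos_power: "r \<in> sos \<Longrightarrow> r ^ n \<in> sos"
  using const_in_sos[of 1] by (induction n) (auto intro: sos_mult simp: one_pCons)

section \<open>Cancelling zeros\<close>

lemma hcoeff_hnorm2: "hcoeff (hnorm2 F) a b = (\<Sum>f\<leftarrow>F. coeff f a * cnj (coeff f b))"
  by (induction F) auto

text \<open>The corner coefficient is the sum of the squared moduli of the m-th coefficients. If it
  vanished, all these coefficients would vanish and with them the whole column m, contradicting that
  m is the outer degree.\<close>

lemma hcoeff_hnorm2_degree:
  assumes "hnorm2 F \<noteq> 0"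
  shows "hcoeff (hnorm2 F) (degree (hnorm2 F)) (degree (hnorm2 F)) \<noteq> 0"
proof
  define m where "m = degree (hnorm2 F)"
  assume "hcoeff (hnorm2 F) (degree (hnorm2 F)) (degree (hnorm2 F)) = 0"
  then have "(\<Sum>f\<leftarrow>F. of_real ((cmod (coeff f m))\<^sup>2) :: complex) = 0"
    by (simp add: hcoeff_hnorm2 complex_norm_square del: of_real_power flip: m_def)
  also have "(\<Sum>f\<leftarrow>F. of_real ((cmod (coeff f m))\<^sup>2) :: complex) = of_real (\<Sum>f\<leftarrow>F. (cmod (coeff f m))\<^sup>2)"
    by (induction F) auto
  finally have "(\<Sum>f\<leftarrow>F. (cmod (coeff f m))\<^sup>2) = 0" by (simp only: of_real_eq_0_iff)
  then have "coeff f m = 0" if "f \<in> set F" for f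
    using that by (subst (asm) sum_list_nonneg_eq_0_iff) auto
  then have "hcoeff (hnorm2 F) a m = 0" for a
    unfolding hcoeff_hnorm2 by (induction F) auto
  then have "lead_coeff (hnorm2 F) = 0"
    by (intro poly_eqI) (simp add: hcoeff_def m_def)
  with assms show False by simp
qed

text \<open>\<open>degree\<close> only bounds the exponent of the outer variable; Hermitian symmetry
  transfers the bound to z.\<close>

lemma bideg_le_degree:
  assumes "hermitian r"
  shows "bideg_le (degree r) r"
proof -
  have *: "b \<le> degree r" if "hcoeff r a b \<noteq> 0" for a b
    using that by (auto simp: hcoeff_def intro!: le_degree)
  moreover have "hcoeff r b a \<noteq> 0" if "hcoeff r a b \<noteq> 0" for a b
    using that assms by (metis complex_cnj_zero hermitian_def)
  ultimately show ?thesis unfolding bideg_le_def by blast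
qed

section \<open>Total degree and the corner coefficient\<close>

lemma deg_z_eq_degree:
  assumes "hermitian r"
  shows "deg_z r = degree r"
proof (cases "r = 0")
  case False
  then obtain a where "hcoeff r a (degree r) \<noteq> 0"
    unfolding hcoeff_def by (metis leading_coeff_0_iff poly_eqI coeff_0)
  then have "hcoeff r (degree r) a \<noteq> 0"
    using assms by (metis complex_cnj_zero hermitian_def)
  moreover have "{a. \<exists>b. hcoeff r a b \<noteq> 0} \<union> {0} \<subseteq> {..degree r}"
    using bideg_le_degree[OF assms] by (auto simp: bideg_le_def)
  ultimately show ?thesis
    unfolding deg_z_def by (intro Max_eqI) (auto intro: finite_subset)
qed (simp add: deg_z_def)

lemma total_deg_eq_iff:
  assumes "hermitian r" "r \<noteq> 0"
  shows "total_deg r = 2 * deg_z r \<longleftrightarrow> hcoeff r (degree r) (degree r) \<noteq> 0"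
proof -
  define d where "d = degree r"
  define S where "S = {a + b |a b. hcoeff r a b \<noteq> 0} \<union> {0}"
  have le: "a \<le> d \<and> b \<le> d" if "hcoeff r a b \<noteq> 0" for a b
    using bideg_le_degree[OF assms(1)] that by (auto simp: bideg_le_def d_def)
  then have sub: "S \<subseteq> {..2 * d}" unfolding S_def by fastforce
  then have fin: "finite S" by (rule finite_subset) simp
  have "Max S = 2 * d \<longleftrightarrow> hcoeff r d d \<noteq> 0"
  proof
    assume "hcoeff r d d \<noteq> 0"
    then have "2 * d \<in> S" by (auto simp: S_def intro!: exI[of _ d])
    with sub fin show "Max S = 2 * d" by (intro Max_eqI) auto
  next
    assume "Max S = 2 * d"
    then have "2 * d \<in> S" using Max_in[OF fin] by (auto simp: S_def)
    show "hcoeff r d d \<noteq> 0"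
    proof (cases "d = 0")
      \<comment> \<open>In degree 0 the maximum may come from the default element 0 of the set, so
        the corner coefficient has to be obtained from \<open>r \<noteq> 0\<close>.\<close>
      case True
      then obtain a b where "hcoeff r a b \<noteq> 0" using assms(2) by (metis hpoly_eqI hcoeff_ring(1))
      then show ?thesis using le True by fastforce
    next
      case False
      then obtain a b where ab: "a + b = 2 * d" "hcoeff r a b \<noteq> 0"
        using \<open>2 * d \<in> S\<close> by (auto simp: S_def)
      then have "a = d" "b = d" using le[OF ab(2)] by auto
      then show ?thesis using ab by simp
    qed
  qed
  then show ?thesis
    by (simp add: total_deg_def deg_z_eq_degree[OF assms(1)] S_def d_def)
qed

text \<open>Compare degrees in z of the outer leading coefficients. By symmetry each is at most the
  outer degree, while the corner coefficient of the product forces their sum to be at least the sum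
  of the outer degrees; so both bounds are equalities.\<close>

lemma hcoeff_degree_factor:
  assumes "hermitian r" "hermitian s"
    and "hcoeff (r * s) (degree r + degree s) (degree r + degree s) \<noteq> 0"
  shows "hcoeff r (degree r) (degree r) \<noteq> 0"
proof -
  have deg: "degree (lead_coeff q) \<le> degree q" if "hermitian q" for q :: hpoly
    using bideg_le_degree[OF that]
    by (intro degree_le) (force simp: bideg_le_def hcoeff_def)
  have "coeff (lead_coeff r * lead_coeff s) (degree r + degree s) \<noteq> 0"
    using assms(3) by (simp add: hcoeff_def coeff_mult_degree_sum)
  then have nz: "lead_coeff r \<noteq> 0"
    and le: "degree r + degree s \<le> degree (lead_coeff r * lead_coeff s)"
    by (auto intro: le_degree)
  note le
  also have "degree (lead_coeff r * lead_coeff s) \<le> degree (lead_coeff r) + degree (lead_coeff s)"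
    by (rule degree_mult_le)
  finally have "degree (lead_coeff r) = degree r"
    using deg[OF assms(1)] deg[OF assms(2)] by linarith
  then show ?thesis using nz unfolding hcoeff_def by (metis leading_coeff_0_iff)
qed

section \<open>Dividing out a factor |z - a|^2\<close>

lemma heval_pCons: "heval (pCons p r) z w = poly p z + cnj w * heval r z w"
  by (simp add: heval_eq)

lemma habs2_linear: "habs2 [:- a, 1:] = [:[:- a, 1:]:] * [:[:- cnj a:], 1:]"
  by (rule hpoly_eqI_heval) (simp add: heval_pCons algebra_simps)

lemma poly_habs2_linear: "poly (habs2 [:- a, 1:]) [:cnj a:] = 0"
  unfolding habs2_linear poly_mult by simp

text \<open>The factor theorem over the inner polynomials splits off \<open>?D\<close>, and
  \<open>star\<close> turns this into divisibility by \<open>?C\<close>. As z - a is a nonzero inner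
  polynomial, the cofactor still vanishes at \<open>[:cnj a:]\<close>, so \<open>?D\<close> can be
  split off once more. Cancellation shows that the quotient is Hermitian.\<close>

lemma habs2_linear_dvd:
  assumes "hermitian r" "poly r [:cnj a:] = 0"
  obtains q where "r = habs2 [:- a, 1:] * q" "hermitian q"
proof -
  let ?C = "[:[:- a, 1:]:]" and ?D = "[:[:- cnj a:], 1:]"
  have D: "[:- [:cnj a:], 1:] = ?D" by simp
  obtain p where p: "r = ?D * p" using assms(2) D by (metis dvdE poly_eq_0_iff_dvd)
  have "star ?D = ?C" by (rule hpoly_eqI_heval) (simp add: heval_pCons)
  then have r: "r = ?C * star p"
    using assms(1) p by (metis hermitian_iff_star star_mult)
  then have "poly ?C [:cnj a:] * poly (star p) [:cnj a:] = 0" using assms(2) by (metis poly_mult)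
  moreover have "poly ?C [:cnj a:] \<noteq> 0" by simp
  ultimately have "poly (star p) [:cnj a:] = 0" by (metis mult_eq_0_iff)
  then obtain q where "star p = ?D * q" using D by (metis dvdE poly_eq_0_iff_dvd)
  then have rq: "r = habs2 [:- a, 1:] * q" using r by (simp only: habs2_linear mult.assoc)
  have "star (habs2 [:- a, 1:]) = habs2 [:- a, 1:]" by (rule hpoly_eqI) simp
  then have "habs2 [:- a, 1:] * star q = habs2 [:- a, 1:] * q"
    using assms(1) rq by (metis hermitian_iff_star star_mult)
  then have "hermitian q" by (auto simp: hermitian_iff_star)
  then show thesis using that rq by blast
qed

lemma hdiag_habs2_mult: "hdiag (habs2 h * R) z = of_real ((cmod (poly h z))\<^sup>2) * hdiag R z"
  by (simp add: hdiag_def complex_norm_square del: of_real_power)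

text \<open>Away from \<open>a\<close> one divides by the positive number |z - a|^2; at
  \<open>a\<close> continuity takes over.\<close>

lemma nonneg_cancel_habs2_linear:
  fixes a :: complex
  assumes "\<forall>z. Re (hdiag (habs2 [:- a, 1:] * q) z) \<ge> 0"
  shows "\<forall>z. Re (hdiag q z) \<ge> 0"
proof -
  have off: "Re (hdiag q z) \<ge> 0" if "z \<noteq> a" for z
    using assms[rule_format, of z] that by (simp add: hdiag_habs2_mult zero_le_mult_iff)
  have "Re (hdiag q a) \<ge> 0" by (rule Re_hdiag_nonneg_at) (rule off)
  with off show ?thesis by metis
qed

lemma hnorm2_common_root:
  assumes "\<forall>f\<in>set F. poly f a = 0"
  obtains G where "hnorm2 F = habs2 [:- a, 1:] * hnorm2 G"
proof -
  have "F = map ((*) [:- a, 1:]) (map (\<lambda>f. f div [:- a, 1:]) F)"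
    using assms by (induction F) (simp_all add: poly_eq_0_iff_dvd del: mult_pCons_left)
  then show thesis using that by (metis habs2_mult_hnorm2)
qed

lemma degree_habs2_linear_mult:
  assumes "q \<noteq> 0"
  shows "degree (habs2 [:- a, 1:] * q) = Suc (degree q)"
proof -
  have "degree (habs2 [:- a, 1:]) = 1" unfolding habs2_linear by simp
  then show ?thesis using assms by (simp add: degree_mult_eq)
qed

lemma Re_hdiag_eq_0_imp_root:
  assumes "hermitian r" "r * s = hnorm2 F" "Re (hdiag r a) = 0" "f \<in> set F"
  shows "poly f a = 0"
proof -
  have "hdiag r a = 0" using assms(3) Im_hdiag[OF assms(1)] by (simp add: complex_eq_iff)
  then have "hdiag (r * s) a = 0" by (simp add: hdiag_def)
  then have "(\<Sum>f\<leftarrow>F. (cmod (poly f a))\<^sup>2) = 0"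
    using assms(2) Re_hdiag_hnorm2[of F a] by simp
  then show ?thesis using assms(4)
    by (subst (asm) sum_list_nonneg_eq_0_iff) auto
qed

text \<open>Strong induction: every cancelled |z - a|^2 is linear in the outer variable and lowers
  \<open>degree r + degree s\<close> by one, whichever factor it is taken from. Only factors taken
  from \<open>r\<close> are collected in \<open>h\<close>.\<close>

lemma quotient_imp_positive_factor:
  assumes "hermitian r" "hermitian s" "\<forall>z. Re (hdiag r z) \<ge> 0" "r \<noteq> 0" "s \<noteq> 0"
    and "r * s = hnorm2 F"
  shows "\<exists>h R. hermitian R \<and> r = habs2 h * R \<and> (\<forall>z. Re (hdiag R z) > 0)
           \<and> total_deg R = 2 * deg_z R"
  using assms
proof (induction "degree r + degree s" arbitrary: r s F rule: less_induct)
  case less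
  show ?case
  proof (cases "\<exists>a. Re (hdiag r a) = 0")
    case False
    then have "\<forall>z. Re (hdiag r z) > 0" using less.prems(3) by (metis order_le_less)
    \<comment> \<open>Outer degrees add, so this is the corner coefficient of the squared
      norm.\<close>
    moreover have "hcoeff (r * s) (degree r + degree s) (degree r + degree s) \<noteq> 0"
      using hcoeff_hnorm2_degree[of F] less.prems by (metis degree_mult_eq no_zero_divisors)
    then have "total_deg r = 2 * deg_z r"
      using hcoeff_degree_factor less.prems total_deg_eq_iff by blast
    moreover have "r = habs2 1 * r" by (rule hpoly_eqI_heval) simp
    ultimately show ?thesis using less.prems(1) by blast
  next
    case True
    then obtain a where a: "Re (hdiag r a) = 0" by blast
    let ?l = "[:- a, 1:]"
    have root: "\<forall>f\<in>set F. poly f a = 0"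
      using Re_hdiag_eq_0_imp_root less.prems a by blast
    obtain G where G: "hnorm2 F = habs2 ?l * hnorm2 G" using hnorm2_common_root[OF root] .
    \<comment> \<open>The product vanishes identically on the complex line where the outer variable
      is conj a; there are no zero divisors, so one of the factors vanishes there.\<close>
    have "poly (r * s) [:cnj a:] = 0"
      unfolding less.prems(6) G poly_mult poly_habs2_linear by simp
    then consider "poly r [:cnj a:] = 0" | "poly s [:cnj a:] = 0" by auto
    then show ?thesis
    proof cases
      case 1
      then obtain q where q: "r = habs2 ?l * q" "hermitian q"
        using habs2_linear_dvd less.prems(1) by blast
      then have "q \<noteq> 0" using less.prems by auto
      have "habs2 ?l * (q * s) = habs2 ?l * hnorm2 G"
        using less.prems(6) G q by (simp add: mult.assoc)
      then have "q * s = hnorm2 G" by simp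
      moreover have "\<forall>z. Re (hdiag q z) \<ge> 0"
        using nonneg_cancel_habs2_linear less.prems(3) q by blast
      ultimately obtain h R where hR: "hermitian R" "q = habs2 h * R"
        "\<forall>z. Re (hdiag R z) > 0" "total_deg R = 2 * deg_z R"
        using less.hyps[of q s G] less.prems q \<open>q \<noteq> 0\<close>
        by (auto simp: degree_habs2_linear_mult)
      have "r = habs2 (?l * h) * R" using q hR(2) by (simp only: habs2_mult mult.assoc)
      then show ?thesis using hR by blast
    next
      case 2
      then obtain q where q: "s = habs2 ?l * q" "hermitian q"
        using habs2_linear_dvd less.prems(2) by blast
      then have "q \<noteq> 0" using less.prems by auto
      have "habs2 ?l * (r * q) = habs2 ?l * hnorm2 G"
        using less.prems(6) G q by (simp add: mult_ac)
      then have "r * q = hnorm2 G" by simp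
      then show ?thesis
        using less.hyps[of r q G] less.prems q \<open>q \<noteq> 0\<close>
        by (auto simp: degree_habs2_linear_mult)
    qed
  qed
qed

section \<open>Positive semidefinite coefficient matrices\<close>

text \<open>On vectors \<open>x a = z ^ a\<close> this is \<open>hdiag r z\<close> once
  \<open>n\<close> exceeds all exponents. Nonnegativity for all vectors is therefore stronger than
  nonnegativity on the diagonal.\<close>

definition hform :: "nat \<Rightarrow> hpoly \<Rightarrow> (nat \<Rightarrow> complex) \<Rightarrow> complex" where
  "hform n r x = (\<Sum>a<n. \<Sum>b<n. hcoeff r a b * x a * cnj (x b))"

lemma hform_cong: "(\<And>a. a < n \<Longrightarrow> x a = y a) \<Longrightarrow> hform n r x = hform n r y"
  unfolding hform_def by (intro sum.cong refl) auto

lemma hform_diff: "hform n (r - s) x = hform n r x - hform n s x"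
  by (simp add: hform_def algebra_simps sum_subtractf)

lemma hform_habs2:
  "hform n (habs2 h) x = of_real ((cmod (\<Sum>a<n. coeff h a * x a))\<^sup>2)"
  unfolding complex_norm_square hform_def
  by (simp add: sum_product mult_ac)

lemma hform_Suc_zero:
  assumes "\<And>a. a \<le> n \<Longrightarrow> hcoeff r a n = 0" "\<And>a. a \<le> n \<Longrightarrow> hcoeff r n a = 0"
  shows "hform (Suc n) r x = hform n r x"
  using assms by (simp add: hform_def)

text \<open>Restriction to two coordinates; it serves to show that a zero last diagonal entry forces
  the last column to vanish.\<close>

lemma hform_two_points:
  assumes "hermitian r" "a < n"
  shows "Re (hform (Suc n) r ((\<lambda>_. 0)(a := u, n := 1)))
    = Re (hcoeff r a a) * (cmod u)\<^sup>2 + 2 * Re (hcoeff r a n * u) + Re (hcoeff r n n)"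
proof -
  let ?x = "(\<lambda>_. 0)(a := u, n := 1) :: nat \<Rightarrow> complex"
  have *: "(\<Sum>i<Suc n. g i) = g a + g n" if "\<And>i. i \<noteq> a \<Longrightarrow> i \<noteq> n \<Longrightarrow> g i = 0" for g :: "nat \<Rightarrow> complex"
  proof -
    have "(\<Sum>i<Suc n. g i) = (\<Sum>i\<in>{a, n}. g i)"
      using that assms(2) by (intro sum.mono_neutral_right) auto
    then show ?thesis using assms(2) by simp
  qed
  have "hform (Suc n) r ?x = hcoeff r a a * (u * cnj u) + hcoeff r a n * u
      + hcoeff r n a * cnj u + hcoeff r n n"
    unfolding hform_def using assms(2) by (subst *, simp, subst (1 2) *) auto
  also have "hcoeff r n a = cnj (hcoeff r a n)" using assms(1) unfolding hermitian_def by blast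
  finally have eq: "hform (Suc n) r ?x = hcoeff r a a * (u * cnj u) + hcoeff r a n * u
      + cnj (hcoeff r a n) * cnj u + hcoeff r n n" .
  show ?thesis
    unfolding eq by (simp add: complex_mult_cnj cmod_power2 algebra_simps)
qed

text \<open>Completion of squares in the last variable, i.e. one step of a Cholesky decomposition:
  the variable eliminated is chosen so that the square split off vanishes.\<close>
lemma psd_imp_sos:
  assumes "hermitian r" "\<And>a b. hcoeff r a b \<noteq> 0 \<Longrightarrow> a < n \<and> b < n"
    and "\<And>x. Re (hform n r x) \<ge> 0"
  shows "r \<in> sos"
  using assms
proof (induction n arbitrary: r)
  case 0
  then have "r = 0" by (intro hpoly_eqI) auto
  then show ?case using const_in_sos[of 0] by simp
next
  case (Suc n)
  define c where "c = Re (hcoeff r n n)"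
  have herm: "hcoeff r a b = cnj (hcoeff r b a)" for a b
    using Suc.prems(1) unfolding hermitian_def by blast
  have c: "hcoeff r n n = of_real c" using herm[of n n] by (auto simp: c_def complex_eq_iff)
  have "Re (hform (Suc n) r ((\<lambda>_. 0)(n := 1))) = c"
    by (simp add: hform_def c_def)
  then have "c \<ge> 0" using Suc.prems(3) by metis
  show ?case
  proof (cases "c = 0")
    case True
    have zero: "hcoeff r a n = 0" if "a < n" for a
    proof (rule ccontr)
      assume nz: "hcoeff r a n \<noteq> 0"
      define m where "m = (cmod (hcoeff r a n))\<^sup>2"
      have "m > 0" using nz by (simp add: m_def)
      \<comment> \<open>\<open>A\<close> strictly dominates the diagonal entry, so along
        \<open>u\<close> the quadratic term contributes at most \<open>m / A\<close> against a
        linear term of \<open>- 2 * (m / A)\<close>, and the form becomes negative.\<close>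
      define A where "A = \<bar>Re (hcoeff r a a)\<bar> + 1"
      have "A > 0" by (simp add: A_def)
      define u where "u = - of_real (1 / A) * cnj (hcoeff r a n)"
      have "Re (hcoeff r a n * u) = - m / A"
        unfolding m_def cmod_power2 using \<open>A > 0\<close>
        by (simp add: u_def power2_eq_square field_simps)
      moreover have "(cmod u)\<^sup>2 = m / A\<^sup>2"
        using \<open>A > 0\<close> by (simp add: u_def m_def norm_mult norm_divide power_divide)
      moreover have "Re (hcoeff r a a) * (cmod u)\<^sup>2 + 2 * Re (hcoeff r a n * u) + Re (hcoeff r n n) \<ge> 0"
        using Suc.prems(3) hform_two_points[OF Suc.prems(1) that, of u] by metis
      ultimately have "Re (hcoeff r a a) * (m / A\<^sup>2) - 2 * (m / A) \<ge> 0" using True c by simp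
      moreover have "Re (hcoeff r a a) * (m / A\<^sup>2) \<le> A * (m / A\<^sup>2)"
        using \<open>m > 0\<close> by (intro mult_right_mono) (auto simp: A_def)
      moreover have "A * (m / A\<^sup>2) = m / A" using \<open>A > 0\<close> by (simp add: power2_eq_square)
      ultimately show False using \<open>m > 0\<close> \<open>A > 0\<close> by (smt (verit) divide_pos_pos)
    qed
    have z1: "hcoeff r a n = 0" for a
      using zero[of a] Suc.prems(2)[of a n] c True by (cases "a = n") force+
    have z2: "hcoeff r n a = 0" for a using z1[of a] herm[of n a] by simp
    show ?thesis
    proof (rule Suc.IH[OF Suc.prems(1)])
      show "a < n \<and> b < n" if "hcoeff r a b \<noteq> 0" for a b
        using Suc.prems(2)[OF that] that z1 z2 by (metis less_SucE)
      show "Re (hform n r x) \<ge> 0" for x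
        using Suc.prems(3)[of x] hform_Suc_zero[of n r x] z1 z2 by simp
    qed
  next
    case False
    then have "c > 0" using \<open>c \<ge> 0\<close> by simp
    \<comment> \<open>The last column divided by the root of the pivot: then \<open>habs2 h\<close>
      has the same last row and column as \<open>r\<close>, and the difference lives in dimension
      \<open>n\<close>.\<close>
    define h where "h = smult (of_real (1 / sqrt c)) (coeff r n)"
    have h: "coeff h a = hcoeff r a n / of_real (sqrt c)" for a
      by (simp add: h_def hcoeff_def)
    define q where "q = r - habs2 h"
    have sq: "complex_of_real (sqrt c) * of_real (sqrt c) = of_real c"
      using \<open>c > 0\<close> by (simp flip: of_real_mult)
    have z1: "hcoeff q a n = 0" for a
      using \<open>c > 0\<close> by (simp add: q_def h c sq)
    have "hermitian q" unfolding q_def hermitian_def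
      using herm by (metis complex_cnj_diff complex_cnj_mult complex_cnj_cnj hcoeff_habs2
        hcoeff_ring(3) mult.commute)
    then have z2: "hcoeff q n a = 0" for a using z1[of a] by (metis complex_cnj_zero hermitian_def)
    have "q \<in> sos"
    proof (rule Suc.IH[OF \<open>hermitian q\<close>])
      show "a < n \<and> b < n" if "hcoeff q a b \<noteq> 0" for a b
      proof -
        have "hcoeff r a b \<noteq> 0 \<or> (hcoeff r a n \<noteq> 0 \<and> hcoeff r b n \<noteq> 0)"
          using that by (auto simp: q_def h)
        then have "a < Suc n \<and> b < Suc n" using Suc.prems(2) by blast
        then show ?thesis using that z1 z2 by (metis less_SucE)
      qed
      show "Re (hform n q x) \<ge> 0" for x
      proof -
        define y where "y = x(n := - (\<Sum>a<n. coeff h a * x a) / of_real (sqrt c))"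
        have "coeff h n = of_real (sqrt c)"
          using \<open>c > 0\<close> sq by (simp add: h c field_simps)
        then have "(\<Sum>a<Suc n. coeff h a * y a) = 0"
          using \<open>c > 0\<close> by (simp add: y_def)
        then have "hform (Suc n) q y = hform (Suc n) r y"
          by (simp only: q_def hform_diff hform_habs2) simp
        then have "Re (hform (Suc n) q y) \<ge> 0" using Suc.prems(3) by simp
        moreover have "hform (Suc n) q y = hform n q y"
          by (rule hform_Suc_zero) (use z1 z2 in auto)
        moreover have "hform n q y = hform n q x" by (rule hform_cong) (auto simp: y_def)
        ultimately show ?thesis by simp
      qed
    qed
    then have "q + habs2 h \<in> sos" by (intro sos_add habs2_in_sos)
    then show ?thesis by (simp add: q_def)
  qed
qed

section \<open>Moments of a nonnegative polynomial\<close>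

text \<open>Orthogonality of characters: the summands are the powers of an n-th root of unity
  \<open>x\<close>, and for distinct \<open>a\<close>, \<open>b\<close> the geometric sum vanishes
  because \<open>x \<noteq> 1\<close>.\<close>

lemma sum_cis_powers:
  assumes "a \<le> L" "b \<le> L"
  shows "(\<Sum>m<Suc L. cis (2 * pi * real m / real (Suc L)) ^ a
            * cnj (cis (2 * pi * real m / real (Suc L))) ^ b)
         = (if a = b then of_nat (Suc L) else 0)"
proof -
  define n where "n = Suc L"
  define x where "x = cis (2 * pi * (real a - real b) / real n)"
  have "n > 0" by (simp add: n_def)
  have pw: "cis (2 * pi * real m / real n) ^ a * cnj (cis (2 * pi * real m / real n)) ^ b = x ^ m" for m
  proof -
    have "real a * (2 * pi * real m / real n) + real b * - (2 * pi * real m / real n)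
        = real m * (2 * pi * (real a - real b) / real n)"
      by (simp add: algebra_simps diff_divide_distrib)
    then show ?thesis
      by (simp only: x_def Complex.DeMoivre cis_cnj cis_mult)
  qed
  show ?thesis
  proof (cases "a = b")
    case True
    then show ?thesis using pw by (simp add: x_def n_def)
  next
    case False
    \<comment> \<open>Otherwise n = L + 1 would divide a - b, whose absolute value is at most
      L.\<close>
    have "x \<noteq> 1"
    proof
      assume "x = 1"
      then have "cos (2 * pi * (real a - real b) / real n) = 1"
        by (metis cis.sel(1) x_def one_complex.sel(1))
      then obtain j :: int where "2 * pi * (real a - real b) / real n = of_int j * 2 * pi"
        by (metis cos_one_2pi_int)
      then have "2 * pi * (real a - real b) = 2 * pi * (of_int j * real n)"
        using \<open>n > 0\<close> by (simp add: field_simps)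
      then have "real a - real b = of_int j * real n" by simp
      then have "real_of_int (int a - int b) = real_of_int (j * int n)" by simp
      then have eq: "int a - int b = j * int n" by (simp only: of_int_eq_iff)
      moreover have "\<bar>int a - int b\<bar> < int n" using assms by (auto simp: n_def)
      ultimately have "\<bar>j\<bar> * int n < 1 * int n" by (simp add: abs_mult)
      then have "j = 0" using \<open>n > 0\<close> by (simp only: mult_less_cancel_right) auto
      with eq False show False by simp
    qed
    have "real n * (2 * pi * (real a - real b) / real n) = 2 * pi * (real a - real b)"
      using \<open>n > 0\<close> by simp
    also have "\<dots> = 2 * pi * real a - 2 * pi * real b" by (rule right_diff_distrib)
    finally have "x ^ n = cis (2 * pi * real a - 2 * pi * real b)"
      by (simp only: x_def Complex.DeMoivre)
    also have "\<dots> = 1"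
      by (simp add: cis_divide[symmetric] cis_multiple_2pi[of "real a"] cis_multiple_2pi[of "real b"])
    finally have "(\<Sum>m<n. x ^ m) = 0" using \<open>x \<noteq> 1\<close> by (simp add: geometric_sum)
    then show ?thesis using pw False by (simp add: n_def)
  qed
qed

text \<open>Averaging over the circle of radius $\sqrt{s}$, done exactly by roots of unity.\<close>
lemma diagonal_sum_nonneg:
  assumes g: "bideg_le L g" and nonneg: "\<forall>z. Re (hdiag g z) \<ge> 0" and "s \<ge> 0"
  shows "(\<Sum>k\<le>L. Re (hcoeff g k k) * s ^ k) \<ge> 0"
proof -
  define \<omega> where "\<omega> m = cis (2 * pi * real m / real (Suc L))" for m
  define t where "t = complex_of_real (sqrt s)"
  have tt: "t ^ k * cnj t ^ k = of_real (s ^ k)" for k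
    using \<open>s \<ge> 0\<close> by (simp add: t_def flip: power_mult_distrib of_real_mult of_real_power)
  have "(\<Sum>m<Suc L. hdiag g (t * \<omega> m))
      = (\<Sum>m<Suc L. \<Sum>a\<le>L. \<Sum>b\<le>L. hcoeff g a b * t ^ a * cnj t ^ b * (\<omega> m ^ a * cnj (\<omega> m) ^ b))"
    unfolding hdiag_def heval_altdef[OF g]
    by (simp add: power_mult_distrib mult_ac)
  also have "\<dots> = (\<Sum>a\<le>L. \<Sum>b\<le>L. \<Sum>m<Suc L. hcoeff g a b * t ^ a * cnj t ^ b * (\<omega> m ^ a * cnj (\<omega> m) ^ b))"
    by (subst sum.swap, subst (2) sum.swap) (rule refl)
  also have "\<dots> = (\<Sum>a\<le>L. \<Sum>b\<le>L. hcoeff g a b * t ^ a * cnj t ^ b * (if a = b then of_nat (Suc L) else 0))"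
    unfolding sum_distrib_left[symmetric] \<omega>_def
    by (intro sum.cong refl arg_cong[where f = "\<lambda>x. _ * x"] sum_cis_powers) auto
  also have "\<dots> = (\<Sum>a\<le>L. hcoeff g a a * of_real (s ^ a) * of_nat (Suc L))"
    by (intro sum.cong refl) (simp add: if_distrib[of "(*) _"] mult.assoc tt[unfolded mult.assoc] cong: if_cong)
  also have "Re \<dots> = real (Suc L) * (\<Sum>k\<le>L. Re (hcoeff g k k) * s ^ k)"
    by (simp add: sum_distrib_left mult_ac del: of_nat_Suc of_real_power)
  finally have "real (Suc L) * (\<Sum>k\<le>L. Re (hcoeff g k k) * s ^ k)
      = (\<Sum>m<Suc L. Re (hdiag g (t * \<omega> m)))" by simp
  also have "\<dots> \<ge> 0" using nonneg by (intro sum_nonneg) auto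
  finally show ?thesis by (simp add: zero_le_mult_iff del: of_nat_Suc)
qed

text \<open>Euler's Beta integral at integers. On the open interval both bases are positive, so
  \<open>powr\<close> agrees with the ordinary power even for exponent 0.\<close>

lemma has_integral_Beta_nat:
  "((\<lambda>t::real. t ^ k * (1 - t) ^ m) has_integral (fact k * fact m / fact (Suc (k + m)))) {0<..<1}"
proof -
  have "Beta (real k + 1) (real m + 1) = fact k * fact m / fact (Suc (k + m))"
    using Gamma_fact[of k, where 'a = real] Gamma_fact[of m, where 'a = real]
      Gamma_fact[of "Suc (k + m)", where 'a = real]
    by (simp add: Beta_def add_ac)
  moreover have "((\<lambda>t. t powr (real k + 1 - 1) * (1 - t) powr (real m + 1 - 1))
      has_integral Beta (real k + 1) (real m + 1)) {0<..<1}"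
    using has_integral_Beta_real[of "real k + 1" "real m + 1"]
    by (simp only: has_integral_Icc_iff_Ioo)
  ultimately show ?thesis
    by (auto simp: powr_realpow elim!: has_integral_eq[rotated])
qed

text \<open>Integrate over $s = t / (1 - t)$; the Beta integral supplies the factorials.\<close>
lemma diagonal_moment_nonneg:
  assumes g: "bideg_le L g" and nonneg: "\<forall>z. Re (hdiag g z) \<ge> 0"
  shows "(\<Sum>k\<le>L. Re (hcoeff g k k) * (fact k * fact (L - k))) \<ge> 0"
proof -
  have "((\<lambda>t. \<Sum>k\<le>L. Re (hcoeff g k k) * (t ^ k * (1 - t) ^ (L - k))) has_integral
      (\<Sum>k\<le>L. Re (hcoeff g k k) * (fact k * fact (L - k) / fact (Suc (k + (L - k)))))) {0<..<1}"
    by (intro has_integral_sum has_integral_mult_right has_integral_Beta_nat) auto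
  then have "(\<Sum>k\<le>L. Re (hcoeff g k k) * (fact k * fact (L - k) / fact (Suc (k + (L - k))))) \<ge> 0"
  proof (rule has_integral_nonneg)
    fix t :: real
    assume t: "t \<in> {0<..<1}"
    have "(\<Sum>k\<le>L. Re (hcoeff g k k) * (t ^ k * (1 - t) ^ (L - k)))
        = (1 - t) ^ L * (\<Sum>k\<le>L. Re (hcoeff g k k) * (t / (1 - t)) ^ k)"
      unfolding sum_distrib_left
      by (intro sum.cong refl) (use t in \<open>auto simp: power_diff power_divide\<close>)
    also have "\<dots> \<ge> 0"
      using t by (intro mult_nonneg_nonneg diagonal_sum_nonneg[OF g nonneg]) auto
    finally show "(\<Sum>k\<le>L. Re (hcoeff g k k) * (t ^ k * (1 - t) ^ (L - k))) \<ge> 0" .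
  qed
  \<comment> \<open>For k \<le> L the denominators are all \<open>fact (Suc L)\<close>, a common
    positive factor.\<close>
  also have "(\<Sum>k\<le>L. Re (hcoeff g k k) * (fact k * fact (L - k) / fact (Suc (k + (L - k)))))
      = (\<Sum>k\<le>L. Re (hcoeff g k k) * (fact k * fact (L - k))) / fact (Suc L)"
    unfolding sum_divide_distrib by (intro sum.cong refl) auto
  finally show ?thesis
    using fact_gt_zero[of "Suc L", where 'a = real]
    by (simp add: zero_le_divide_iff not_le[symmetric] del: fact_Suc)
qed

section \<open>Powers of the Fubini-Study polynomial W\<close>

definition fs :: hpoly where
  "fs = 1 + monom (monom 1 1) 1"

lemma heval_fs [simp]: "heval fs z w = 1 + z * cnj w"
  unfolding fs_def heval_ring heval_monom by simp

lemma fs_in_sos: "fs \<in> sos"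
proof -
  have "fs = hnorm2 [1, [:0, 1:]]" by (rule hpoly_eqI_heval) simp
  then show ?thesis unfolding sos_def by (rule range_eqI)
qed

lemma hermitian_mult: "hermitian r \<Longrightarrow> hermitian s \<Longrightarrow> hermitian (r * s)"
  by (simp add: hermitian_iff_star star_mult)

lemma hermitian_diff: "hermitian r \<Longrightarrow> hermitian s \<Longrightarrow> hermitian (r - s)"
  unfolding hermitian_def by (metis complex_cnj_diff hcoeff_ring(3))

lemma hermitian_of_real: "hermitian [:[:of_real c:]:]"
  by (simp add: hermitian_iff_heval)

lemma hermitian_fs_power: "hermitian (fs ^ n)"
  unfolding hermitian_iff_heval by (simp add: mult.commute)

lemma fs_power_mult_monom:
  "fs ^ n * monom (monom c i) j = (\<Sum>q\<le>n. monom (monom (of_nat (n choose q) * c) (q + i)) (q + j))"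
proof (rule hpoly_eqI_heval)
  fix z w
  have "(1 + z * cnj w) ^ n = (\<Sum>q\<le>n. of_nat (n choose q) * (z * cnj w) ^ q)"
    using binomial_ring[of "z * cnj w" 1 n] by (simp add: add.commute)
  then show "heval (fs ^ n * monom (monom c i) j) z w
      = heval (\<Sum>q\<le>n. monom (monom (of_nat (n choose q) * c) (q + i)) (q + j)) z w"
    by (simp add: sum_distrib_left power_add power_mult_distrib mult_ac)
qed

lemma hcoeff_fs_power_mult_monom:
  "hcoeff (fs ^ n * monom (monom c i) j) u v =
     (if i \<le> u \<and> j \<le> v \<and> u - i = v - j then of_nat (n choose (u - i)) * c else 0)"
proof -
  have *: "u = q + i \<and> v = q + j \<longleftrightarrow> q = u - i \<and> (i \<le> u \<and> j \<le> v \<and> u - i = v - j)" for q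
    by arith
  show ?thesis
    unfolding fs_power_mult_monom hcoeff_sum hcoeff_monom *
    by (cases "i \<le> u \<and> j \<le> v \<and> u - i = v - j") (auto simp: sum.delta)
qed

lemma hcoeff_fs_power:
  "hcoeff (fs ^ n) a b = (if a = b then of_nat (n choose a) else 0)"
proof -
  have "monom (monom 1 0) 0 = (1 :: hpoly)" by (simp add: monom_0 one_pCons)
  then show ?thesis using hcoeff_fs_power_mult_monom[of n 1 0 0 a b] by simp
qed

lemma bideg_le_fs_power: "bideg_le n (fs ^ n)"
  unfolding bideg_le_def hcoeff_fs_power by (auto simp: not_less[symmetric])

lemma hdiag_fs_power: "hdiag (fs ^ n) z = of_real ((1 + (cmod z)\<^sup>2) ^ n)"
  by (simp add: hdiag_def flip: complex_norm_square)

text \<open>The matrix of \<open>fs ^ d\<close> is diagonal with binomial entries at least 1, so it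
  dominates the identity; and the sum of the moduli of all entries of \<open>q\<close> bounds the
  form of \<open>q\<close> by a multiple of the identity.\<close>

lemma sos_archimedean:
  assumes "hermitian q" "bideg_le d q"
  shows "\<exists>C\<ge>0. [:[:of_real C:]:] * fs ^ d - q \<in> sos"
proof -
  define C where "C = (\<Sum>a<Suc d. \<Sum>b<Suc d. cmod (hcoeff q a b))"
  have "C \<ge> 0" unfolding C_def by (intro sum_nonneg) auto
  moreover have "[:[:of_real C:]:] * fs ^ d - q \<in> sos"
  proof (rule psd_imp_sos[where n = "Suc d"])
    show "hermitian ([:[:of_real C:]:] * fs ^ d - q)"
      by (intro hermitian_diff hermitian_mult hermitian_of_real hermitian_fs_power assms(1))
    show "a < Suc d \<and> b < Suc d" if "hcoeff ([:[:of_real C:]:] * fs ^ d - q) a b \<noteq> 0" for a b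
      using that assms(2) bideg_le_fs_power[of d] unfolding bideg_le_def less_Suc_eq_le
      by (metis diff_zero hcoeff_ring(3) hcoeff_scale mult_zero_right)
    show "Re (hform (Suc d) ([:[:of_real C:]:] * fs ^ d - q) x) \<ge> 0" for x
    proof -
      define S where "S = (\<Sum>i<Suc d. (cmod (x i))\<^sup>2)"
      have "S \<ge> 0" unfolding S_def by (intro sum_nonneg) auto
      have sq: "(cmod (x i))\<^sup>2 \<le> S" if "i < Suc d" for i
        unfolding S_def using that by (intro member_le_sum) auto
      have "Re (hform (Suc d) q x) \<le> cmod (hform (Suc d) q x)" by (rule complex_Re_le_cmod)
      also have "\<dots> \<le> (\<Sum>a<Suc d. \<Sum>b<Suc d. cmod (hcoeff q a b * x a * cnj (x b)))"
        unfolding hform_def by (intro order_trans[OF norm_sum] sum_mono) auto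
      also have "\<dots> \<le> (\<Sum>a<Suc d. \<Sum>b<Suc d. cmod (hcoeff q a b) * S)"
      proof (intro sum_mono)
        fix a b assume "a \<in> {..<Suc d}" "b \<in> {..<Suc d}"
        then have "(cmod (x a))\<^sup>2 \<le> S" "(cmod (x b))\<^sup>2 \<le> S" using sq by auto
        moreover have "2 * (cmod (x a) * cmod (x b)) \<le> (cmod (x a))\<^sup>2 + (cmod (x b))\<^sup>2"
          using sum_squares_bound[of "cmod (x a)" "cmod (x b)"] by simp
        ultimately have "cmod (x a) * cmod (x b) \<le> S" by linarith
        then show "cmod (hcoeff q a b * x a * cnj (x b)) \<le> cmod (hcoeff q a b) * S"
          by (simp add: norm_mult mult.assoc mult_left_mono)
      qed
      also have "\<dots> = C * S" by (simp add: C_def sum_distrib_right del: sum.lessThan_Suc)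
      finally have 1: "Re (hform (Suc d) q x) \<le> C * S" .
      have "hform (Suc d) ([:[:of_real C:]:] * fs ^ d) x
          = (\<Sum>a<Suc d. \<Sum>b<Suc d. if a = b then of_real (C * (d choose a)) * x a * cnj (x b) else 0)"
        unfolding hform_def by (intro sum.cong refl) (simp add: hcoeff_fs_power)
      also have "\<dots> = (\<Sum>a<Suc d. of_real (C * (d choose a)) * x a * cnj (x a))"
        by (intro sum.cong refl) (simp add: sum.delta del: sum.lessThan_Suc)
      also have "\<dots> = of_real (\<Sum>a<Suc d. C * (d choose a) * (cmod (x a))\<^sup>2)"
        by (simp add: complex_norm_square mult.assoc del: of_real_power sum.lessThan_Suc)
      finally have "Re (hform (Suc d) ([:[:of_real C:]:] * fs ^ d) x)
          = (\<Sum>a<Suc d. C * (d choose a) * (cmod (x a))\<^sup>2)" by (simp only: Re_complex_of_real)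
      also have "\<dots> \<ge> (\<Sum>a<Suc d. C * (cmod (x a))\<^sup>2)"
      proof (intro sum_mono)
        fix a assume "a \<in> {..<Suc d}"
        then have "1 \<le> real (d choose a)" by (simp add: Suc_leI)
        then have "C * 1 \<le> C * real (d choose a)" using \<open>C \<ge> 0\<close> by (rule mult_left_mono)
        then show "C * (cmod (x a))\<^sup>2 \<le> C * (d choose a) * (cmod (x a))\<^sup>2"
          by (intro mult_right_mono) auto
      qed
      also have "(\<Sum>a<Suc d. C * (cmod (x a))\<^sup>2) = C * S"
        unfolding S_def sum_distrib_left ..
      finally show ?thesis using 1 by (simp add: hform_diff)
    qed
  qed
  ultimately show ?thesis by blast
qed

section \<open>Strict positivity on the Riemann sphere\<close>

lemma Re_hdiag_attains_min_on_disc: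
  "\<exists>x. \<forall>z. cmod z \<le> 1 \<longrightarrow> Re (hdiag q x) \<le> Re (hdiag q z)"
proof -
  have "continuous_on (cball 0 1) (\<lambda>z. Re (hdiag q z))"
    by (intro continuous_at_imp_continuous_on ballI continuous_Re isCont_hdiag)
  then obtain x where "\<forall>y\<in>cball 0 1. Re (hdiag q x) \<le> Re (hdiag q y)"
    using continuous_attains_inf[of "cball (0 :: complex) 1" "\<lambda>z. Re (hdiag q z)"] by auto
  then show ?thesis by (intro exI[of _ x]) (simp only: Ball_def mem_cball_0)
qed

text \<open>The top coefficient is the value at infinity of p / (1 + |z|^2)^d, so this quotient is a
  positive continuous function on the compact Riemann sphere.\<close>

lemma positive_imp_bounded_below:
  assumes "hermitian p" and p: "bideg_le d p" and top: "hcoeff p d d \<noteq> 0"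
    and pos: "\<forall>z. Re (hdiag p z) > 0"
  shows "\<exists>\<delta>>0. \<forall>z. Re (hdiag p z) \<ge> \<delta> * (1 + (cmod z)\<^sup>2) ^ d"
proof -
  \<comment> \<open>\<open>q\<close> is \<open>p\<close> in the chart at infinity; both are minimised over the closed unit disc.\<close>
  define q where "q = hpoly_of d (\<lambda>a b. hcoeff p (d - a) (d - b))"
  have q: "heval q z w = (\<Sum>a\<le>d. \<Sum>b\<le>d. hcoeff p a b * z ^ (d - a) * cnj w ^ (d - b))" for z w
    unfolding q_def heval_hpoly_of
    by (rule sum.reindex_bij_witness[of _ "\<lambda>a. d - a" "\<lambda>a. d - a"]; simp?)
       (rule sum.reindex_bij_witness[of _ "\<lambda>b. d - b" "\<lambda>b. d - b"]; simp)
  have pq: "Re (hdiag p z) = (cmod z)\<^sup>2 ^ d * Re (hdiag q (inverse z))" if "z \<noteq> 0" for z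
  proof -
    have inv: "w ^ a = w ^ d * inverse w ^ (d - a)" if "a \<le> d" "w \<noteq> 0" for w :: complex and a
      using that by (simp add: power_diff field_simps)
    have "hdiag p z = (\<Sum>a\<le>d. \<Sum>b\<le>d. hcoeff p a b *
        (z ^ d * inverse z ^ (d - a)) * (cnj z ^ d * inverse (cnj z) ^ (d - b)))"
      unfolding hdiag_def heval_altdef[OF p]
      by (intro sum.cong refl arg_cong2[where f = "(*)"] inv) (use that in auto)
    also have "\<dots> = (z * cnj z) ^ d * hdiag q (inverse z)"
      unfolding hdiag_def q by (simp add: sum_distrib_left power_mult_distrib mult_ac)
    also have "\<dots> = of_real ((cmod z)\<^sup>2 ^ d) * hdiag q (inverse z)"
      by (simp flip: complex_norm_square)
    finally show ?thesis by (simp del: of_real_power)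
  qed
  have qpos: "Re (hdiag q z) > 0" if "z \<noteq> 0" for z
    using pos[rule_format, of "inverse z"] pq[of "inverse z"] that by (simp add: zero_less_mult_iff)
  \<comment> \<open>At the point at infinity only a weak inequality survives the limit; it becomes
    strict because the value is the real, nonzero top coefficient.\<close>
  have "Re (hdiag q 0) \<ge> 0" by (rule Re_hdiag_nonneg_at) (rule less_imp_le[OF qpos])
  moreover have "hdiag q 0 = hcoeff p d d"
  proof -
    have "hdiag q 0 = hcoeff q 0 0"
      by (simp add: hdiag_def heval_eq hcoeff_def poly_0_coeff_0)
    then show ?thesis by (simp add: q_def)
  qed
  moreover have "Im (hdiag q 0) = 0"
    using assms(1) \<open>hdiag q 0 = hcoeff p d d\<close> unfolding hermitian_def
    by (metis complex_cnj_cancel_iff Reals_cnj_iff complex_is_Real_iff)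
  ultimately have "Re (hdiag q 0) > 0" using top by (auto simp: complex_eq_iff)
  with qpos have qpos: "Re (hdiag q z) > 0" for z by (cases "z = 0") auto
  obtain x where x: "\<forall>z. cmod z \<le> 1 \<longrightarrow> Re (hdiag p x) \<le> Re (hdiag p z)"
    using Re_hdiag_attains_min_on_disc by blast
  obtain y where y: "\<forall>z. cmod z \<le> 1 \<longrightarrow> Re (hdiag q y) \<le> Re (hdiag q z)"
    using Re_hdiag_attains_min_on_disc by blast
  define m where "m = min (Re (hdiag p x)) (Re (hdiag q y))"
  have "m > 0" using pos qpos by (simp add: m_def)
  \<comment> \<open>The factor 2^d comes from 1 + |z|^2 \<le> 2 inside the disc and 1 + |z|^2 \<le>
    2 |z|^2 outside.\<close>
  have "Re (hdiag p z) \<ge> m / 2 ^ d * (1 + (cmod z)\<^sup>2) ^ d" for z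
  proof (cases "cmod z \<le> 1")
    case True
    then have "(1 + (cmod z)\<^sup>2) ^ d \<le> 2 ^ d" by (intro power_mono) (auto simp: power_le_one)
    then have "m / 2 ^ d * (1 + (cmod z)\<^sup>2) ^ d \<le> m / 2 ^ d * 2 ^ d"
      using \<open>m > 0\<close> by (intro mult_left_mono) auto
    also have "\<dots> \<le> Re (hdiag p z)" using x True by (auto simp: m_def min_le_iff_disj)
    finally show ?thesis .
  next
    case False
    then have "z \<noteq> 0" by auto
    have "cmod (inverse z) \<le> 1" using False by (simp add: norm_inverse inverse_le_1_iff)
    then have le: "m \<le> Re (hdiag q (inverse z))" using y by (auto simp: m_def min_le_iff_disj)
    have "(cmod z)\<^sup>2 \<ge> 1" using False by (simp add: one_le_power)
    then have "(1 + (cmod z)\<^sup>2) ^ d \<le> (2 * (cmod z)\<^sup>2) ^ d" by (intro power_mono) auto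
    then have "m / 2 ^ d * (1 + (cmod z)\<^sup>2) ^ d \<le> m / 2 ^ d * (2 * (cmod z)\<^sup>2) ^ d"
      using \<open>m > 0\<close> by (intro mult_left_mono) auto
    also have "\<dots> = (cmod z)\<^sup>2 ^ d * m" by (simp add: power_mult_distrib)
    also have "(cmod z)\<^sup>2 ^ d * m \<le> (cmod z)\<^sup>2 ^ d * Re (hdiag q (inverse z))"
      using le by (intro mult_left_mono) auto
    also have "\<dots> = Re (hdiag p z)" using pq \<open>z \<noteq> 0\<close> by simp
    finally show ?thesis .
  qed
  then show ?thesis using \<open>m > 0\<close> by (intro exI[of _ "m / 2 ^ d"]) auto
qed

section \<open>Normal ordering of the moment form\<close>

text \<open>The quotient is (b + u choose a) a! / u!, and Vandermonde's identity splits the binomial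
  into terms that regroup as stated. The conditional guards the truncated subtraction.\<close>

lemma fact_quotient_expand:
  assumes "a + v = b + u" "a \<le> d"
  shows "(fact (a + v) / (fact u * fact v) :: complex) =
    (\<Sum>k\<le>d. of_nat ((a choose k) * (b choose k) * fact k) *
       (if a - k \<le> u then 1 / fact (u - (a - k)) else 0))"
proof -
  have "(fact (a + v) / (fact u * fact v) :: complex) = of_nat ((b + u) choose a) * (fact a / fact u)"
    using binomial_fact[of a "a + v", where 'a = complex] by (simp add: assms(1)[symmetric])
  also have "\<dots> = (\<Sum>k\<le>a. of_nat ((b choose k) * (u choose (a - k))) * (fact a / fact u))"
    unfolding vandermonde[symmetric] of_nat_sum sum_distrib_right ..
  also have "\<dots> = (\<Sum>k\<le>a. of_nat ((a choose k) * (b choose k) * fact k) *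
       (if a - k \<le> u then 1 / fact (u - (a - k)) else 0))"
  proof (intro sum.cong refl)
    fix k assume "k \<in> {..a}"
    then have "k \<le> a" by simp
    show "of_nat ((b choose k) * (u choose (a - k))) * (fact a / fact u) =
      of_nat ((a choose k) * (b choose k) * fact k) *
       (if a - k \<le> u then 1 / fact (u - (a - k)) else (0 :: complex))"
    proof (cases "a - k \<le> u")
      case True
      then show ?thesis
        using binomial_fact[OF True, where 'a = complex] binomial_fact[OF \<open>k \<le> a\<close>, where 'a = complex]
        by simp
    next
      case False
      then show ?thesis by (simp add: binomial_eq_0)
    qed
  qed
  \<comment> \<open>The added terms vanish; a range independent of \<open>a\<close> lets the sums be
    interchanged later.\<close>
  also have "\<dots> = (\<Sum>k\<le>d. of_nat ((a choose k) * (b choose k) * fact k) *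
       (if a - k \<le> u then 1 / fact (u - (a - k)) else 0))"
    using assms(2) by (intro sum.mono_neutral_left) (auto simp: binomial_eq_0)
  finally show ?thesis .
qed

text \<open>The factor produced by contracting \<open>k\<close> pairs $\partial_1 z_1$ and \<open>l\<close> pairs $\partial_2 z_2$
  when $z_1^a z_2^{d-a}$ and $\partial_1^b \partial_2^{d-b}$ are brought into normal order.\<close>
definition contraction_coeff :: "nat \<Rightarrow> nat \<Rightarrow> nat \<Rightarrow> nat \<Rightarrow> nat \<Rightarrow> complex" where
  "contraction_coeff d k l a b = of_nat ((a choose k) * (b choose k) * fact k) *
     of_nat (((d - a) choose l) * ((d - b) choose l) * fact l)"

lemma contraction_coeff_nonzero:
  "contraction_coeff d k l a b \<noteq> 0 \<Longrightarrow> k \<le> a \<and> k \<le> b \<and> l \<le> d - a \<and> l \<le> d - b"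
  by (auto simp: contraction_coeff_def binomial_eq_0_iff not_less)

text \<open>The matrix of $f \mapsto \int z^a \overline{z}^b |f|^2 (1 + |z|^2)^{-L-2}$ with $L = N + 2d$,
  $\deg f \le N + d$, up to a positive constant and the rescaling of the $u$-th coefficient of \<open>f\<close> by
  $u!\,(N + d - u)!$.\<close>
definition moment_coeff :: "nat \<Rightarrow> nat \<Rightarrow> nat \<Rightarrow> nat \<Rightarrow> nat \<Rightarrow> nat \<Rightarrow> complex" where
  "moment_coeff N d a b u v = (if a + v = b + u then
     fact (a + v) * fact (N + 2 * d - (a + v)) /
       (fact u * fact v * fact (N + d - u) * fact (N + d - v)) else 0)"

text \<open>One factorial expansion for each homogeneous coordinate: for \<open>a, b, u, v\<close>
  and for the complements \<open>d - a, d - b, N + d - u, N + d - v\<close>. The two reciprocal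
  factorials that remain have arguments summing to N + k + l, so their product is a binomial
  coefficient of \<open>fs ^ (N + k + l)\<close> divided by (N + k + l)!.\<close>

lemma moment_coeff_expand:
  assumes "a \<le> d" "b \<le> d" "u \<le> N + d" "v \<le> N + d"
  shows "moment_coeff N d a b u v = (\<Sum>k\<le>d. \<Sum>l\<le>d. contraction_coeff d k l a b / fact (N + k + l) *
      hcoeff (fs ^ (N + k + l) * monom (monom 1 (a - k)) (b - k)) u v)"
proof (cases "a + v = b + u")
  case False
  have "contraction_coeff d k l a b / fact (N + k + l) *
      hcoeff (fs ^ (N + k + l) * monom (monom 1 (a - k)) (b - k)) u v = 0" for k l
  proof (rule ccontr)
    assume nz: "\<not> ?thesis"
    then have "k \<le> a" "k \<le> b" using contraction_coeff_nonzero by auto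
    moreover from nz have "a - k \<le> u \<and> b - k \<le> v \<and> u - (a - k) = v - (b - k)"
      unfolding hcoeff_fs_power_mult_monom by (auto split: if_splits)
    ultimately show False using False by arith
  qed
  then show ?thesis using False unfolding moment_coeff_def by (simp only: if_False sum.neutral_const)
next
  case True
  define X where "X k = (if a - k \<le> u then 1 / fact (u - (a - k)) else 0 :: complex)" for k
  define Y where "Y l = (if (d - a) - l \<le> N + d - u
    then 1 / fact ((N + d - u) - ((d - a) - l)) else 0 :: complex)" for l
  have eq': "(d - a) + (N + d - v) = (d - b) + (N + d - u)"
    and sum': "N + 2 * d - (a + v) = (d - a) + (N + d - v)"
    using True assms by arith+
  have "moment_coeff N d a b u v = (fact (a + v) / (fact u * fact v)) *
      (fact ((d - a) + (N + d - v)) / (fact (N + d - u) * fact (N + d - v)))"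
    using True unfolding moment_coeff_def sum' by simp
  also have "\<dots> = (\<Sum>k\<le>d. \<Sum>l\<le>d. contraction_coeff d k l a b * (X k * Y l))"
    unfolding fact_quotient_expand[OF True \<open>a \<le> d\<close>] fact_quotient_expand[OF eq' diff_le_self]
      sum_product contraction_coeff_def X_def Y_def
    by (intro sum.cong refl) (simp only: mult_ac)
  also have "\<dots> = (\<Sum>k\<le>d. \<Sum>l\<le>d. contraction_coeff d k l a b / fact (N + k + l) *
      hcoeff (fs ^ (N + k + l) * monom (monom 1 (a - k)) (b - k)) u v)"
  proof (intro sum.cong refl)
    fix k l
    show "contraction_coeff d k l a b * (X k * Y l) = contraction_coeff d k l a b / fact (N + k + l) *
      hcoeff (fs ^ (N + k + l) * monom (monom 1 (a - k)) (b - k)) u v"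
    proof (cases "contraction_coeff d k l a b = 0")
      case False
      then have kl: "k \<le> a" "k \<le> b" "l \<le> d - a" "l \<le> d - b"
        using contraction_coeff_nonzero by auto
      have "X k * Y l = hcoeff (fs ^ (N + k + l) * monom (monom 1 (a - k)) (b - k)) u v / fact (N + k + l)"
      proof (cases "a - k \<le> u")
        case au: True
        have cond: "a - k \<le> u \<and> b - k \<le> v \<and> u - (a - k) = v - (b - k)"
          using au kl True by arith
        \<comment> \<open>Additive witnesses replace the truncated subtractions and make the index
          comparison linear.\<close>
        obtain a1 where a1: "a = k + a1" using kl(1) le_Suc_ex by blast
        obtain d1 where d1: "d - a = l + d1" using kl(3) le_Suc_ex by blast
        obtain p where p: "u = a1 + p" using au a1 le_Suc_ex by auto
        have "d = a + (l + d1)" using d1 assms(1) by linarith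
        then have sub: "d - a - l = d1" "N + d - u = N + k + l + d1 - p" "u - (a - k) = p"
          using d1 a1 p by simp_all
        show ?thesis
        proof (cases "u - (a - k) \<le> N + k + l")
          case le: True
          have "(d - a) - l \<le> N + d - u" "(N + d - u) - ((d - a) - l) = (N + k + l) - (u - (a - k))"
            using le unfolding sub by linarith+
          then show ?thesis
            unfolding X_def Y_def hcoeff_fs_power_mult_monom
            using cond binomial_fact[OF le, where 'a = complex] by simp
        next
          case gt: False
          have "\<not> (d - a) - l \<le> N + d - u"
            using gt \<open>u \<le> N + d\<close> \<open>d = a + (l + d1)\<close> a1 p unfolding sub by linarith
          then show ?thesis
            unfolding Y_def hcoeff_fs_power_mult_monom using cond gt by (simp add: binomial_eq_0)
        qed
      qed (auto simp: X_def hcoeff_fs_power_mult_monom)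
      then show ?thesis by simp
    qed simp
  qed
  finally show ?thesis .
qed

text \<open>The power of \<open>fs\<close> is included so that a common factor \<open>fs ^ N\<close>
  can be taken out of all contractions of the moment matrix.\<close>

definition contraction :: "nat \<Rightarrow> nat \<Rightarrow> nat \<Rightarrow> hpoly \<Rightarrow> hpoly" where
  "contraction d k l p = fs ^ (k + l) *
     (\<Sum>a\<le>d. \<Sum>b\<le>d. monom (monom (hcoeff p a b * contraction_coeff d k l a b) (a - k)) (b - k))"

lemma contraction_0_0:
  assumes "bideg_le d p"
  shows "contraction d 0 0 p = p"
  using hpoly_of_hcoeff[OF assms]
  by (simp add: contraction_def contraction_coeff_def hpoly_of_def)

text \<open>A nonzero contraction has l \<le> d - a, so the exponent in z is at most (a - k) + (k +
  l) = a + l \<le> d; likewise for the other variable.\<close>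

lemma bideg_le_contraction: "bideg_le d (contraction d k l p)"
proof -
  have "bideg_le d (fs ^ (k + l) * monom (monom (hcoeff p a b * contraction_coeff d k l a b) (a - k)) (b - k))"
    if "a \<le> d" "b \<le> d" for a b
  proof (cases "contraction_coeff d k l a b = 0")
    case True
    then show ?thesis by (simp add: bideg_le_def)
  next
    case False
    then have kl: "k \<le> a" "k \<le> b" "l \<le> d - a" "l \<le> d - b"
      using contraction_coeff_nonzero by auto
    show ?thesis
      unfolding bideg_le_def hcoeff_fs_power_mult_monom
    proof (intro allI impI)
      fix u v
      assume "(if a - k \<le> u \<and> b - k \<le> v \<and> u - (a - k) = v - (b - k)
        then of_nat (k + l choose (u - (a - k))) * (hcoeff p a b * contraction_coeff d k l a b) else 0) \<noteq> 0"
      then have "u - (a - k) = v - (b - k)" "k + l choose (u - (a - k)) \<noteq> 0"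
        by (auto split: if_splits)
      then have "u - (a - k) \<le> k + l" "v - (b - k) \<le> k + l"
        by (auto simp: binomial_eq_0_iff not_less)
      then show "u \<le> d \<and> v \<le> d" using kl that by arith
    qed
  qed
  then show ?thesis
    unfolding contraction_def sum_distrib_left by (intro bideg_le_sum) auto
qed

lemma hermitian_contraction:
  assumes "hermitian p"
  shows "hermitian (contraction d k l p)"
proof -
  define s where "s = (\<Sum>a\<le>d. \<Sum>b\<le>d. monom (monom (hcoeff p a b * contraction_coeff d k l a b) (a - k)) (b - k))"
  have c: "cnj (hcoeff p a b) = hcoeff p b a" for a b
    using assms unfolding hermitian_def by (metis complex_cnj_cnj)
  have K: "cnj (contraction_coeff d k l a b) = contraction_coeff d k l b a" for a b
    by (simp add: contraction_coeff_def mult_ac)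
  have "heval s z w = cnj (heval s w z)" for z w
  proof -
    have "cnj (heval s w z) = (\<Sum>a\<le>d. \<Sum>b\<le>d. hcoeff p b a * contraction_coeff d k l b a * cnj w ^ (a - k) * z ^ (b - k))"
      by (simp add: s_def c K)
    also have "\<dots> = heval s z w"
      by (subst sum.swap) (simp add: s_def mult_ac)
    finally show ?thesis ..
  qed
  then have "hermitian s" unfolding hermitian_iff_heval by blast
  then show ?thesis
    unfolding contraction_def s_def[symmetric] by (intro hermitian_mult hermitian_fs_power)
qed

section \<open>The moment matrix as a Hermitian polynomial\<close>

definition moment_hpoly :: "nat \<Rightarrow> nat \<Rightarrow> hpoly \<Rightarrow> hpoly" where
  "moment_hpoly N d p = hpoly_of (N + d) (\<lambda>u v. \<Sum>a\<le>d. \<Sum>b\<le>d. hcoeff p a b * moment_coeff N d a b u v)"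

text \<open>The term k = l = 0 is \<open>fs ^ N * p\<close> over N! when
  \<open>bideg_le d p\<close>; relative to it the others carry the weights N! / (N + k + l)!, which
  are O(1/N).\<close>

lemma moment_hpoly_expand:
  "moment_hpoly N d p = (\<Sum>k\<le>d. \<Sum>l\<le>d. [:[:1 / fact (N + k + l):]:] * (fs ^ N * contraction d k l p))"
    (is "_ = ?rhs")
proof (rule hpoly_eqI)
  fix u v
  have coeff_contraction: "hcoeff (fs ^ N * contraction d k l p) u v
      = (\<Sum>a\<le>d. \<Sum>b\<le>d. hcoeff p a b * contraction_coeff d k l a b *
          hcoeff (fs ^ (N + k + l) * monom (monom 1 (a - k)) (b - k)) u v)" for k l
    by (simp add: contraction_def mult.assoc[symmetric] flip: power_add)
       (simp add: add.assoc sum_distrib_left hcoeff_fs_power_mult_monom if_distrib mult_ac cong: if_cong)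
  show "hcoeff (moment_hpoly N d p) u v = hcoeff ?rhs u v"
  proof (cases "u \<le> N + d \<and> v \<le> N + d")
    case True
    have "hcoeff (moment_hpoly N d p) u v = (\<Sum>a\<le>d. \<Sum>b\<le>d. \<Sum>k\<le>d. \<Sum>l\<le>d.
        hcoeff p a b * (contraction_coeff d k l a b / fact (N + k + l) *
          hcoeff (fs ^ (N + k + l) * monom (monom 1 (a - k)) (b - k)) u v))"
      using True by (simp add: moment_hpoly_def moment_coeff_expand sum_distrib_left)
    also have "\<dots> = (\<Sum>k\<le>d. \<Sum>l\<le>d. \<Sum>a\<le>d. \<Sum>b\<le>d.
        hcoeff p a b * (contraction_coeff d k l a b / fact (N + k + l) *
          hcoeff (fs ^ (N + k + l) * monom (monom 1 (a - k)) (b - k)) u v))"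
      by (rule sum_swap4)
    also have "\<dots> = hcoeff ?rhs u v"
      by (simp add: coeff_contraction sum_distrib_left mult_ac)
    finally show ?thesis .
  next
    case False
    \<comment> \<open>Outside this range the left side is 0 by definition, so the right side must be
      shown to vanish too.\<close>
    have "bideg_le (N + d) (fs ^ N * contraction d k l p)" for k l
      by (intro bideg_le_mult bideg_le_fs_power bideg_le_contraction)
    then have "hcoeff (fs ^ N * contraction d k l p) u v = 0" for k l
      using False unfolding bideg_le_def by blast
    then show ?thesis using False by (auto simp: moment_hpoly_def)
  qed
qed

lemma moment_coeff_swap: "moment_coeff N d b a v u = moment_coeff N d a b u v"
  by (simp add: moment_coeff_def mult_ac eq_commute)

lemma cnj_moment_coeff [simp]: "cnj (moment_coeff N d a b u v) = moment_coeff N d a b u v"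
  by (simp add: moment_coeff_def)

lemma hermitian_moment_hpoly:
  assumes "hermitian p"
  shows "hermitian (moment_hpoly N d p)"
proof -
  have c: "cnj (hcoeff p a b) = hcoeff p b a" for a b
    using assms unfolding hermitian_def by (metis complex_cnj_cnj)
  show ?thesis unfolding hermitian_def
  proof (intro allI)
    fix u v
    have "(\<Sum>a\<le>d. \<Sum>b\<le>d. hcoeff p a b * moment_coeff N d a b u v)
        = (\<Sum>a\<le>d. \<Sum>b\<le>d. hcoeff p b a * moment_coeff N d a b v u)"
      by (subst sum.swap) (simp add: moment_coeff_swap)
    then show "hcoeff (moment_hpoly N d p) u v = cnj (hcoeff (moment_hpoly N d p) v u)"
      by (auto simp: moment_hpoly_def c)
  qed
qed

text \<open>The form of this matrix at \<open>x\<close> is the diagonal moment sum of p |f|^2 for a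
  suitable polynomial \<open>f\<close>, hence nonnegative; a positive semidefinite matrix gives a
  squared norm.\<close>

lemma moment_hpoly_in_sos:
  assumes "hermitian p" and p: "bideg_le d p" and nonneg: "\<forall>z. Re (hdiag p z) \<ge> 0"
  shows "moment_hpoly N d p \<in> sos"
proof (rule psd_imp_sos[where n = "Suc (N + d)", OF hermitian_moment_hpoly[OF assms(1)]])
  show "u < Suc (N + d) \<and> v < Suc (N + d)" if "hcoeff (moment_hpoly N d p) u v \<noteq> 0" for u v
    using that unfolding moment_hpoly_def by (auto split: if_splits)
  fix x :: "nat \<Rightarrow> complex"
  define M where "M = N + d"
  define L where "L = d + M"
  \<comment> \<open>The factorials are the rescaling built into \<open>moment_coeff\<close>. The
    conjugate is needed because the condition a + v = b + u pairs the row index u with the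
    conjugated coefficients of \<open>f\<close>.\<close>
  define y where "y i = cnj (x i) / (fact i * fact (M - i))" for i
  define f where "f = (\<Sum>i\<le>M. monom (y i) i)"
  have f: "coeff f i = (if i \<le> M then y i else 0)" for i
    by (simp add: f_def coeff_sum)
  define g where "g = p * habs2 f"
  have "degree f \<le> M" unfolding f_def
    by (intro degree_sum_le) (auto intro: order_trans[OF degree_monom_le])
  then have fM: "bideg_le M (habs2 f)" using bideg_le_habs2 bideg_le_mono by blast
  have g: "bideg_le L g" unfolding g_def L_def by (intro bideg_le_mult p fM)
  have "Re (hdiag g z) \<ge> 0" for z
    using nonneg unfolding g_def mult.commute[of p] by (simp add: hdiag_habs2_mult)
  then have "0 \<le> (\<Sum>k\<le>L. Re (hcoeff g k k) * (fact k * fact (L - k)))"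
    using diagonal_moment_nonneg[OF g] by blast
  also have "\<dots> = Re (\<Sum>k\<le>L. hcoeff g k k * (fact k * fact (L - k)))"
  proof -
    have "(fact k * fact m :: complex) = of_real (fact k * fact m)" for k m by simp
    then have "Re (x * (fact k * fact m)) = Re x * (fact k * fact m)" for x k m
      by (simp del: of_real_mult of_real_fact)
    then show ?thesis by simp
  qed
  also have "(\<Sum>k\<le>L. hcoeff g k k * (fact k * fact (L - k))) = hform (Suc M) (moment_hpoly N d p) x"
  proof -
    define w where "w k = (fact k * fact (L - k) :: complex)" for k
    define h where "h a b v u = (if a + v = b + u then hcoeff p a b * (y v * cnj (y u)) * w (a + v) else 0)"
      for a b v u
    \<comment> \<open>A diagonal coefficient collects the products with k = a + v and k = b + u;
      summing over k leaves the single condition a + v = b + u.\<close>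
    have "(\<Sum>k\<le>L. hcoeff g k k * w k) = (\<Sum>k\<le>L. \<Sum>a\<le>d. \<Sum>b\<le>d. \<Sum>v\<le>M. \<Sum>u\<le>M.
        if k = a + v \<and> k = b + u then hcoeff p a b * (y v * cnj (y u)) * w k else 0)"
      unfolding g_def hpoly_mult_expand[OF p fM]
      by (intro sum.cong refl) (simp add: f sum_distrib_right if_distrib[of "\<lambda>t. t * _"] cong: if_cong)
    also have "\<dots> = (\<Sum>a\<le>d. \<Sum>b\<le>d. \<Sum>v\<le>M. \<Sum>u\<le>M. \<Sum>k\<le>L.
        if k = a + v \<and> k = b + u then hcoeff p a b * (y v * cnj (y u)) * w k else 0)"
      by (simp only: sum.swap[of _ _ "{..L}"])
    also have "\<dots> = (\<Sum>a\<le>d. \<Sum>b\<le>d. \<Sum>v\<le>M. \<Sum>u\<le>M. h a b v u)"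
    proof (intro sum.cong refl)
      fix a b v u assume "a \<in> {..d}" "v \<in> {..M}"
      then have "a + v \<le> L" by (simp add: L_def)
      have "(\<Sum>k\<le>L. if k = a + v \<and> k = b + u then hcoeff p a b * (y v * cnj (y u)) * w k else 0)
          = (\<Sum>k\<le>L. if k = a + v then h a b v u else 0)"
        by (intro sum.cong refl) (auto simp: h_def)
      then show "(\<Sum>k\<le>L. if k = a + v \<and> k = b + u then hcoeff p a b * (y v * cnj (y u)) * w k else 0) = h a b v u"
        using \<open>a + v \<le> L\<close> by (simp add: sum.delta)
    qed
    also have "\<dots> = (\<Sum>v\<le>M. \<Sum>u\<le>M. \<Sum>a\<le>d. \<Sum>b\<le>d. h a b v u)"
      by (rule sum_swap4)
    also have "\<dots> = (\<Sum>u\<le>M. \<Sum>v\<le>M. \<Sum>a\<le>d. \<Sum>b\<le>d. h a b v u)"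
      by (rule sum.swap)
    also have "\<dots> = (\<Sum>u\<le>M. \<Sum>v\<le>M. hcoeff (moment_hpoly N d p) u v * x u * cnj (x v))"
    proof (intro sum.cong refl)
      fix u v assume "u \<in> {..M}" "v \<in> {..M}"
      then have uv: "u \<le> N + d" "v \<le> N + d" by (auto simp: M_def)
      have L: "L = N + 2 * d" by (simp add: L_def M_def)
      have "h a b v u = hcoeff p a b * moment_coeff N d a b u v * x u * cnj (x v)" for a b
        by (simp add: h_def moment_coeff_def y_def w_def L M_def mult_ac)
      then show "(\<Sum>a\<le>d. \<Sum>b\<le>d. h a b v u) = hcoeff (moment_hpoly N d p) u v * x u * cnj (x v)"
        using uv by (simp add: moment_hpoly_def sum_distrib_right)
    qed
    also have "\<dots> = hform (Suc M) (moment_hpoly N d p) x"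
      by (simp only: hform_def lessThan_Suc_atMost)
    finally show ?thesis by (simp only: w_def)
  qed
  finally show "0 \<le> Re (hform (Suc (N + d)) (moment_hpoly N d p) x)" by (simp only: M_def)
qed

text \<open>Dehomogenised form of the theorem of Quillen and of Catlin and D'Angelo in two
  variables. A multiple of \<open>fs ^ d\<close> is held in reserve to absorb the lower-order
  contractions.\<close>

lemma positive_imp_fs_power_mult_in_sos:
  assumes "hermitian p" "bideg_le d p" "hcoeff p d d \<noteq> 0" "\<forall>z. Re (hdiag p z) > 0"
  shows "\<exists>N. fs ^ N * p \<in> sos"
proof -
  obtain \<delta> where "\<delta> > 0" and \<delta>: "Re (hdiag p z) \<ge> \<delta> * (1 + (cmod z)\<^sup>2) ^ d" for z
    using positive_imp_bounded_below[OF assms] by blast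
  define c where "c t = ([:[:complex_of_real t:]:] :: hpoly)" for t
  have c_add: "c (s + t) = c s + c t" and c_mult: "c (s * t) = c s * c t" for s t
    by (simp_all add: c_def)
  have c_sum: "c (\<Sum>i\<in>I. t i) = (\<Sum>i\<in>I. c (t i))" for I :: "(nat \<times> nat) set" and t
    by (induction I rule: infinite_finite_induct) (simp_all add: c_add, simp_all add: c_def)
  have c_sos: "c t \<in> sos" if "t \<ge> 0" for t unfolding c_def using const_in_sos[OF that] .
  \<comment> \<open>Removing the reserve keeps the diagonal values nonnegative, which is all the
    moment argument needs.\<close>
  define p1 where "p1 = p - c \<delta> * fs ^ d"
  have h1: "hermitian p1" unfolding p1_def c_def
    by (intro hermitian_diff hermitian_mult hermitian_of_real hermitian_fs_power assms(1))
  have b1: "bideg_le d p1"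
    using assms(2) bideg_le_fs_power[of d]
    unfolding p1_def bideg_le_def c_def hcoeff_ring hcoeff_scale by (metis diff_zero mult_zero_right)
  have "Re (hdiag p1 z) \<ge> 0" for z
    using \<delta>[of z] hdiag_fs_power[of d z] by (simp add: p1_def hdiag_def c_def)
  then have sosH: "moment_hpoly N d p1 \<in> sos" for N by (intro moment_hpoly_in_sos h1 b1) auto
  define q where "q i = contraction d (fst i) (snd i) p1" for i
  have "\<exists>C\<ge>0. c C * fs ^ d - q i \<in> sos" for i
    unfolding c_def q_def
    by (intro sos_archimedean hermitian_contraction bideg_le_contraction h1)
  \<comment> \<open>The \<open>q i\<close> do not involve \<open>N\<close>, so these bounds are
    fixed before \<open>N\<close> is chosen.\<close>
  then obtain C where C: "C i \<ge> 0" "c (C i) * fs ^ d - q i \<in> sos" for i by metis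
  define I where "I = {..d} \<times> {..d} - {(0, 0)}"
  have "finite I" by (simp add: I_def)
  \<comment> \<open>Each weight \<open>\<epsilon> i\<close> is at most 1/(N + 1), so this
    \<open>N\<close> keeps the total correction within \<delta>.\<close>
  obtain N :: nat where N: "(\<Sum>i\<in>I. C i) / \<delta> \<le> real N" using real_arch_simple by blast
  define \<epsilon> where "\<epsilon> i = (fact N / fact (N + fst i + snd i) :: real)" for i
  have "\<epsilon> i \<ge> 0" for i by (simp add: \<epsilon>_def)
  have \<epsilon>_le: "\<epsilon> i \<le> 1 / real (Suc N)" if "i \<in> I" for i
  proof -
    have "Suc N \<le> N + fst i + snd i" using that by (cases i) (auto simp: I_def)
    then have "fact (Suc N) \<le> (fact (N + fst i + snd i) :: real)" by (rule fact_mono)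
    then have "\<epsilon> i \<le> fact N / fact (Suc N)" unfolding \<epsilon>_def by (intro divide_left_mono) auto
    also have "\<dots> = 1 / real (Suc N)" by simp
    finally show ?thesis .
  qed
  have "(\<Sum>i\<in>I. \<epsilon> i * C i) \<le> (\<Sum>i\<in>I. 1 / real (Suc N) * C i)"
    by (intro sum_mono mult_right_mono \<epsilon>_le C)
  also have "\<dots> = (\<Sum>i\<in>I. C i) / real (Suc N)" by (simp add: sum_divide_distrib)
  also have "\<dots> \<le> \<delta>"
  proof -
    have "(\<Sum>i\<in>I. C i) \<le> real N * \<delta>" using N \<open>\<delta> > 0\<close> by (simp add: pos_divide_le_eq)
    also have "\<dots> \<le> \<delta> * real (Suc N)" using \<open>\<delta> > 0\<close> by (simp add: algebra_simps)
    finally show ?thesis by (simp add: pos_divide_le_eq del: of_nat_Suc)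
  qed
  finally have slack: "0 \<le> \<delta> - (\<Sum>i\<in>I. \<epsilon> i * C i)" by simp
  have "c (fact N) * moment_hpoly N d p1 = (\<Sum>i\<in>{..d} \<times> {..d}. c (\<epsilon> i) * (fs ^ N * q i))"
  proof -
    have "c (\<epsilon> (k, l)) = c (fact N) * [:[:1 / fact (N + k + l):]:]" for k l
      by (simp add: c_def \<epsilon>_def)
    then show ?thesis
      unfolding moment_hpoly_expand sum_distrib_left sum.cartesian_product
      by (intro sum.cong refl) (auto simp: q_def)
  qed
  also have "{..d} \<times> {..d} = insert (0, 0) I" by (auto simp: I_def)
  also have "(\<Sum>i\<in>insert (0, 0) I. c (\<epsilon> i) * (fs ^ N * q i))
      = fs ^ N * p1 + (\<Sum>i\<in>I. c (\<epsilon> i) * (fs ^ N * q i))"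
  proof -
    have "c (\<epsilon> (0, 0)) * (fs ^ N * q (0, 0)) = fs ^ N * p1"
      by (simp add: c_def \<epsilon>_def q_def contraction_0_0[OF b1])
         (simp only: one_pCons[symmetric] smult_1_left)
    moreover have "(0, 0) \<notin> I" by (simp add: I_def)
    ultimately show ?thesis using \<open>finite I\<close> by (simp only: sum.insert not_False_eq_True)
  qed
  finally have main: "c (fact N) * moment_hpoly N d p1 = fs ^ N * p1 + (\<Sum>i\<in>I. c (\<epsilon> i) * (fs ^ N * q i))" .
  \<comment> \<open>The reserve splits into the amounts \<open>\<epsilon> i * C i\<close>, which
    make every correction a squared norm, and a nonnegative remainder.\<close>
  have "fs ^ N * p = c (fact N) * moment_hpoly N d p1
      + fs ^ N * (c (\<delta> - (\<Sum>i\<in>I. \<epsilon> i * C i)) * fs ^ d + (\<Sum>i\<in>I. c (\<epsilon> i) * (c (C i) * fs ^ d - q i)))"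
  proof -
    have "c \<delta> = c (\<delta> - (\<Sum>i\<in>I. \<epsilon> i * C i)) + (\<Sum>i\<in>I. c (\<epsilon> i) * c (C i))"
      by (simp only: c_mult[symmetric] c_sum[symmetric] c_add[symmetric]) simp
    then have 1: "p = p1 + (c (\<delta> - (\<Sum>i\<in>I. \<epsilon> i * C i)) + (\<Sum>i\<in>I. c (\<epsilon> i) * c (C i))) * fs ^ d"
      by (simp add: p1_def)
    have 2: "(\<Sum>i\<in>I. c (\<epsilon> i) * (fs ^ N * q i)) = fs ^ N * (\<Sum>i\<in>I. c (\<epsilon> i) * q i)"
      unfolding sum_distrib_left by (simp only: mult_ac)
    have 3: "(\<Sum>i\<in>I. c (\<epsilon> i) * (c (C i) * fs ^ d - q i))
        = (\<Sum>i\<in>I. c (\<epsilon> i) * c (C i)) * fs ^ d - (\<Sum>i\<in>I. c (\<epsilon> i) * q i)"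
      by (simp only: right_diff_distrib sum_subtractf sum_distrib_right mult.assoc)
    show ?thesis unfolding main 2 3 by (subst 1) (simp add: algebra_simps)
  qed
  also have "\<dots> \<in> sos"
    using slack C \<open>\<And>i. \<epsilon> i \<ge> 0\<close>
    by (intro sos_add sos_mult sos_sum sos_power c_sos sosH fs_in_sos) auto
  finally show ?thesis by blast
qed

section \<open>Assembling the equivalences\<close>

lemma positive_imp_Q1:
  assumes "hermitian R" "\<forall>z. Re (hdiag R z) > 0" "total_deg R = 2 * deg_z R"
  shows "R \<in> Q1"
proof -
  have "R \<noteq> 0" using assms(2) by (auto simp: hdiag_def)
  then have "hcoeff R (degree R) (degree R) \<noteq> 0" using assms total_deg_eq_iff by blast
  then obtain N where "fs ^ N * R \<in> sos"
    using positive_imp_fs_power_mult_in_sos[OF assms(1) bideg_le_degree[OF assms(1)]] assms(2) by blast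
  then obtain F where F: "R * fs ^ N = hnorm2 F" by (auto simp: sos_def mult.commute)
  obtain G where G: "fs ^ N = hnorm2 G" using sos_power[OF fs_in_sos] by (auto simp: sos_def)
  \<comment> \<open>The value 1 at the origin excludes that all components of \<open>G\<close>
    vanish.\<close>
  have "hdiag (hnorm2 G) 0 = 1" unfolding G[symmetric] hdiag_fs_power by simp
  have "\<exists>g\<in>set G. g \<noteq> 0"
  proof (rule ccontr)
    assume "\<not> ?thesis"
    then have "hnorm2 G = 0" by (induction G) auto
    with \<open>hdiag (hnorm2 G) 0 = 1\<close> show False by (simp add: hdiag_def)
  qed
  then show ?thesis using assms(1) F G unfolding Q1_def by auto
qed

theorem theorem4p1:
  fixes r :: hpoly
  assumes "hermitian r" and "\<forall>z. Re (hdiag r z) \<ge> 0"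
  shows "((\<exists>h R. hermitian R \<and> r = habs2 h * R \<and> (\<forall>z. Re (hdiag R z) > 0)
              \<and> total_deg R = 2 * deg_z R)
          \<longleftrightarrow> (\<exists>h R. r = habs2 h * R \<and> R \<in> Q1))
       \<and> ((\<exists>h R. r = habs2 h * R \<and> R \<in> Q1) \<longleftrightarrow> r \<in> Q1)
       \<and> (r \<in> Q1 \<longleftrightarrow> (\<exists>h R. r = habs2 h * R \<and> R \<in> Q1'))
       \<and> ((\<exists>h R. r = habs2 h * R \<and> R \<in> Q1') \<longleftrightarrow> r \<in> Q1')"
    (is "(?s1 \<longleftrightarrow> ?s2) \<and> (?s2 \<longleftrightarrow> ?s3) \<and> (?s3 \<longleftrightarrow> ?s4) \<and> (?s4 \<longleftrightarrow> ?s5)")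
proof -
  \<comment> \<open>The cycle \<open>?s1\<close>, \<open>?s2\<close>, \<open>?s3\<close>,
    \<open>?s5\<close>, \<open>?s1\<close> is closed, and \<open>?s4\<close> is attached to
    \<open>?s5\<close> in both directions. A factor |h|^2 is absorbed by multiplying every component
    of \<open>F\<close> by \<open>h\<close>.\<close>
  have one: "habs2 1 = 1" by (rule hpoly_eqI_heval) simp
  have "?s2" if "?s1" using that positive_imp_Q1 by blast
  moreover have "?s3" if "?s2"
  proof -
    obtain h R F G where "r = habs2 h * R" "\<exists>g\<in>set G. g \<noteq> 0" "R * hnorm2 G = hnorm2 F"
      using \<open>?s2\<close> unfolding Q1_def by blast
    then have "r * hnorm2 G = hnorm2 (map ((*) h) F)" "\<exists>g\<in>set G. g \<noteq> 0"
      by (simp_all add: habs2_mult_hnorm2[symmetric] mult.assoc)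
    then show ?thesis using assms(1) unfolding Q1_def by blast
  qed
  moreover have "?s5" if "?s3"
  proof -
    obtain F G where G: "\<exists>g\<in>set G. g \<noteq> 0" and FG: "r * hnorm2 G = hnorm2 F"
      using \<open>?s3\<close> unfolding Q1_def by auto
    have "hnorm2 G \<noteq> 0" using G hnorm2_eq_0_imp by blast
    then show ?thesis
      using assms FG hermitian_hnorm2 Re_hdiag_hnorm2_nonneg unfolding Q1'_def by blast
  qed
  moreover have "?s1" if "?s5"
  proof (cases "r = 0")
    case True
    \<comment> \<open>The zero polynomial is |0|^2 times the positive constant 1.\<close>
    have "hermitian 1" "\<forall>z. Re (hdiag 1 z) > 0"
      by (simp_all add: hermitian_iff_heval hdiag_def)
    moreover from this have "total_deg 1 = 2 * deg_z 1"
      by (subst total_deg_eq_iff) (simp_all add: hcoeff_def)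
    moreover have "r = habs2 0 * 1" using True by simp
    ultimately show ?thesis by blast
  next
    case False
    then show ?thesis
      using \<open>?s5\<close> quotient_imp_positive_factor[of r] unfolding Q1'_def by auto
  qed
  moreover have "?s4" if "?s5" using that one by (metis mult_1)
  moreover have "?s5" if "?s4"
  proof -
    obtain h R s F where "r = habs2 h * R" "hermitian s" "\<forall>z. Re (hdiag s z) \<ge> 0" "s \<noteq> 0"
      "R * s = hnorm2 F"
      using \<open>?s4\<close> unfolding Q1'_def by blast
    then have "r * s = hnorm2 (map ((*) h) F)" "hermitian s" "\<forall>z. Re (hdiag s z) \<ge> 0" "s \<noteq> 0"
      by (simp_all add: habs2_mult_hnorm2[symmetric] mult.assoc)
    then show ?thesis using assms unfolding Q1'_def by blast
  qed
  ultimately show ?thesis by blast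
qed

end
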